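(* Let $Q$ be an origin-symmetric star body in $\mathbb{R}^n$ and let $\mu$ be a finite even Borel measure on $\mathbb{S}^{n-1}$. Then there exists an origin-symmetric convex body $K$ in $\mathbb{R}^n$ such that $\widetilde{C}_0(K,Q,\cdot)=\mu$ if and only if $\mu$ is not concentrated on any great sub-sphere of $\mathbb{S}^{n-1}$ and $\mu(\mathbb{S}^{n-1})$ is equal to the volume of $Q$.
   Context: $\mathbb{S}^{n-1}$ is the unit sphere of $\mathbb{R}^n$ and $du$ is the standard surface measure on it. A star body is a compact set $Q\subset\mathbb{R}^n$, star-shaped with respect to the origin (the segment joining any point of $Q$ to the origin lies in $Q$), whose radial function $\rho_Q(u)=\max\{\lambda:\lambda u\in Q\}$, $u\in\mathbb{S}^{n-1}$, is positive and continuous. A convex body is a compact convex set with non-empty interior; an origin-symmetric convex body contains the origin in its interior. A measure on $\mathbb{S}^{n-1}$ is even if it takes the same value on antipodal measurable subsets $\eta$ and $-\eta$. A great sub-sphere is a set $\mathbb{S}^{n-1}\cap\xi$ with $\xi$ a proper linear subspace of $\mathbb{R}^n$; $\mu$ is concentrated on a Borel set $S$ if $\mu(\mathbb{S}^{n-1}\setminus S)=0$. For a star body $Q$ and a convex body $K$ containing the origin in its interior, the generalized $0$-th dual curvature measure is the Borel measure on $\mathbb{S}^{n-1}$ $$\widetilde{C}_0(K,Q,\eta)=\frac1n\int_{\boldsymbol{\alpha}_K^*(\eta)}\rho_Q^{n}(u)\,du,\qquad \eta\subset\mathbb{S}^{n-1}\text{ Borel},$$ where $\boldsymbol{\alpha}_K^*(\eta)=\{u\in\mathbb{S}^{n-1}:\rho_K(u)u\in\nu_K^{-1}(\eta)\}$,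 $\rho_K(u)=\max\{\lambda:\lambda u\in K\}$, and $\nu_K^{-1}(\eta)$ is the set of boundary points of $K$ having an outer unit normal vector belonging to $\eta$. *)

theory Defs
  imports "HOL-Analysis.Analysis"
begin

abbreviation sphere_borel :: "(real ^ 'n) measure" where
  "sphere_borel \<equiv> restrict_space borel (sphere 0 1)"

text \<open>The surface measure of a Borel subset of the sphere is n times the volume of the cone over it
  with apex 0 (polar coordinates), obtained here by pushing the volume on the punctured unit ball
  forward under radial projection. It is completed because the sets over which it is used in the
  dual curvature measure below are in general only measurable up to null sets.\<close>

definition surface_measure :: "(real ^ 'n) measure" where
  "surface_measure = completion (scale_measure (of_nat CARD('n))
     (distr (restrict_space lborel (cball 0 1 - {0})) sphere_borel (\<lambda>x. x /\<^sub>R norm x)))"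

lemma emeasure_surface_measure:
  fixes A :: "(real ^ 'n) set"
  assumes "A \<in> sets sphere_borel"
  shows "emeasure surface_measure A = of_nat CARD('n) *
    emeasure lborel {x \<in> cball 0 1 - {0}. x /\<^sub>R norm x \<in> A}"
proof -
  let ?B = "cball 0 1 - {0} :: (real ^ 'n) set"
  have m: "(\<lambda>x. x /\<^sub>R norm x) \<in> measurable (restrict_space lborel ?B) (sphere_borel :: (real ^ 'n) measure)"
  proof (rule measurable_restrict_space2)
    show "(\<lambda>x. x /\<^sub>R norm x) \<in> space (restrict_space lborel ?B) \<rightarrow> sphere 0 1"
      by (auto simp: space_restrict_space)
    show "(\<lambda>x. x /\<^sub>R norm x) \<in> borel_measurable (restrict_space lborel ?B)"
      by (rule measurable_restrict_space1) measurable
  qed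
  have "emeasure surface_measure A = of_nat CARD('n) *
      emeasure (restrict_space lborel ?B) ((\<lambda>x. x /\<^sub>R norm x) -` A \<inter> space (restrict_space lborel ?B))"
    using assms by (simp add: surface_measure_def emeasure_distr[OF m])
  also have "emeasure (restrict_space lborel ?B) ((\<lambda>x. x /\<^sub>R norm x) -` A \<inter> space (restrict_space lborel ?B))
      = emeasure lborel ((\<lambda>x. x /\<^sub>R norm x) -` A \<inter> space (restrict_space lborel ?B))"
    by (rule emeasure_restrict_space) (auto simp: space_restrict_space)
  also have "(\<lambda>x. x /\<^sub>R norm x) -` A \<inter> space (restrict_space lborel ?B)
      = {x \<in> ?B. x /\<^sub>R norm x \<in> A}"
    by (auto simp: space_restrict_space)
  finally show ?thesis .
qed

definition radial :: "(real ^ 'n) set \<Rightarrow> real ^ 'n \<Rightarrow> real" where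
  "radial Q u = (GREATEST l. l *\<^sub>R u \<in> Q)"

text \<open>Membership of 0 excludes the empty set, for which the maximum defining the radial function
  does not exist.\<close>

definition star_body :: "(real ^ 'n) set \<Rightarrow> bool" where
  "star_body Q \<longleftrightarrow> compact Q \<and> 0 \<in> Q \<and> (\<forall>x\<in>Q. closed_segment 0 x \<subseteq> Q) \<and>
     (\<forall>u\<in>sphere 0 1. 0 < radial Q u) \<and> continuous_on (sphere 0 1) (radial Q)"

definition convex_body :: "(real ^ 'n) set \<Rightarrow> bool" where
  "convex_body K \<longleftrightarrow> compact K \<and> convex K \<and> interior K \<noteq> {}"

definition origin_symmetric :: "(real ^ 'n) set \<Rightarrow> bool" where
  "origin_symmetric A \<longleftrightarrow> uminus ` A = A"

definition outer_unit_normal :: "(real ^ 'n) set \<Rightarrow> real ^ 'n \<Rightarrow> real ^ 'n \<Rightarrow> bool" where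
  "outer_unit_normal K x v \<longleftrightarrow> norm v = 1 \<and> (\<forall>y\<in>K. v \<bullet> y \<le> v \<bullet> x)"

definition inverse_spherical_image :: "(real ^ 'n) set \<Rightarrow> (real ^ 'n) set \<Rightarrow> (real ^ 'n) set" where
  "inverse_spherical_image K \<eta> = {x \<in> frontier K. \<exists>v\<in>\<eta>. outer_unit_normal K x v}"

definition reverse_radial_Gauss_image :: "(real ^ 'n) set \<Rightarrow> (real ^ 'n) set \<Rightarrow> (real ^ 'n) set" where
  "reverse_radial_Gauss_image K \<eta> =
     {u \<in> sphere 0 1. radial K u *\<^sub>R u \<in> inverse_spherical_image K \<eta>}"

definition dual_curvature_0 :: "(real ^ 'n) set \<Rightarrow> (real ^ 'n) set \<Rightarrow> (real ^ 'n) set \<Rightarrow> ennreal" where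
  "dual_curvature_0 K Q \<eta> = ennreal (1 / CARD('n)) *
     (\<integral>\<^sup>+u\<in>reverse_radial_Gauss_image K \<eta>. ennreal (radial Q u ^ CARD('n)) \<partial>surface_measure)"

definition even_measure :: "(real ^ 'n) measure \<Rightarrow> bool" where
  "even_measure \<mu> \<longleftrightarrow> (\<forall>\<eta>\<in>sets \<mu>. emeasure \<mu> (uminus ` \<eta>) = emeasure \<mu> \<eta>)"

definition great_subsphere :: "(real ^ 'n) set \<Rightarrow> bool" where
  "great_subsphere S \<longleftrightarrow> (\<exists>\<xi>. subspace \<xi> \<and> \<xi> \<noteq> UNIV \<and> S = sphere 0 1 \<inter> \<xi>)"

definition concentrated_on :: "(real ^ 'n) measure \<Rightarrow> (real ^ 'n) set \<Rightarrow> bool" where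
  "concentrated_on \<mu> S \<longleftrightarrow> emeasure \<mu> (sphere 0 1 - S) = 0"

end

theory Submission
  imports Defs "HOL-Complex_Analysis.Great_Picard"
begin

text \<open>Put \<tau>(A) = (1/n) \<integral>_A \<rho>_Q^n du; by polar coordinates \<tau> is the cone measure of Q, of total mass
  vol(Q). The body K with x \<in> K iff |x.v| \<le> exp \<phi>(v) for all unit v has the gauge
  N_\<phi>(u) = max_v |u.v| exp(-\<phi>(v)). Consider the energy E(\<phi>) = \<integral>\<phi> d\<mu> + \<integral> ln N_\<phi> d\<tau> on all
  continuous \<phi>. Replacing \<phi> by its double conjugate does not increase E, and E is invariant under
  adding constants because the masses agree. For a conjugate \<phi> with maximum 0 and minimum -b one gets
  E(\<phi>) \<ge> \<epsilon> b - C, because \<phi> is bounded below off a thin band, which carries at most mass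
  vol(Q) - 2 \<epsilon> of \<mu>, and ln N_\<phi> \<ge> b - const off a thin band of small \<tau>-mass. So Arzela-Ascoli yields
  a minimizer. The gauge of the corresponding body has a unique subgradient almost everywhere, hence
  the first variation in even directions exists; its vanishing says that the radial Gauss map pushes
  \<tau> forward to \<mu>. Conversely, the total mass of the measure of a given K comes from the existence of
  supporting hyperplanes. If almost all normals of K were orthogonal to a unit vector e, there would be
  boundary points in directions u arbitrarily close to e with a normal v orthogonal to e, so that
  h_K(v) = \<rho>_K(u) u.v would be arbitrarily small.\<close>

section \<open>The cone measure of a star body\<close>

text \<open>The energy is the Kantorovich dual of transporting \<tau> to \<mu> with cost -ln |u.v|.
  Here \<phi> stands in for the logarithm of the support function and ln N_\<phi> is minus that of
  the radial function. By construction \<phi>(v) + ln N_\<phi>(u) \<ge> ln |u.v|, and equality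
  forces v or -v to be a normal at the boundary point in direction u. Index 0 makes this possible:
  the weight \<rho>_Q^n du does not involve K, so \<tau> is fixed in advance. The cost is unbounded
  near u.v = 0, so fixing the additive constant does not yet give compactness: the body may flatten,
  the minimum of \<phi> tending to minus infinity. The condition on great sub-spheres excludes just
  this. Minimizing over all continuous \<phi>, not only over logarithms of support functions, leaves
  every direction free for variations. The body is symmetric whatever \<phi> is, because the
  absolute value is built into N_\<phi>. The maximizers v are then known only up to sign, hence the
  restriction to even directions.\<close>

lemma nn_integral_lborel_scale:
  fixes f :: "'a::euclidean_space \<Rightarrow> ennreal"
  assumes [measurable]: "f \<in> borel_measurable borel" and c: "c \<noteq> 0"
  shows "(\<integral>\<^sup>+x. f x \<partial>lborel) = ennreal (\<bar>c\<bar> ^ DIM('a)) * (\<integral>\<^sup>+x. f (c *\<^sub>R x) \<partial>lborel)"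
proof -
  have "(\<integral>\<^sup>+x. f x \<partial>lborel) = (\<integral>\<^sup>+x. f x \<partial>density (distr lborel borel (\<lambda>x. 0 + c *\<^sub>R x)) (\<lambda>_. \<bar>c\<bar> ^ DIM('a)))"
    by (subst lborel_affine[OF c, of 0]) simp
  also have "\<dots> = ennreal (\<bar>c\<bar> ^ DIM('a)) * (\<integral>\<^sup>+x. f (c *\<^sub>R x) \<partial>lborel)"
    by (simp add: nn_integral_density nn_integral_distr nn_integral_cmult)
  finally show ?thesis .
qed

text \<open>Dilations preserve \<open>sgn x\<close>, so only the Jacobian appears. The radius is an
  \<open>ennreal\<close> because it will be a value of a simple function, 0 included.\<close>

lemma emeasure_truncated_cone:
  fixes A :: "(real ^ 'n) set"
  assumes [measurable]: "A \<in> sets borel" and y: "y < top"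
  shows "emeasure lborel {x. x \<noteq> 0 \<and> ennreal (norm x) < y \<and> sgn x \<in> A} =
    y ^ CARD('n) * emeasure lborel {x. x \<noteq> 0 \<and> norm x < 1 \<and> sgn x \<in> A}"
proof (cases "y = 0")
  case True
  then show ?thesis by simp
next
  case False
  with y obtain c where c: "y = ennreal c" "c > 0"
    by (cases y) (auto simp: less_le)
  have "emeasure lborel {x. x \<noteq> 0 \<and> ennreal (norm x) < y \<and> sgn x \<in> A} =
      (\<integral>\<^sup>+x. indicator {x. x \<noteq> 0 \<and> ennreal (norm x) < y \<and> sgn x \<in> A} x \<partial>lborel)"
    by (subst nn_integral_indicator) auto
  also have "\<dots> = ennreal (\<bar>c\<bar> ^ CARD('n)) *
      (\<integral>\<^sup>+x. indicator {x. x \<noteq> 0 \<and> ennreal (norm x) < y \<and> sgn x \<in> A} (c *\<^sub>R x) \<partial>lborel)"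
    using c(2) by (subst nn_integral_lborel_scale[of _ c]) auto
  also have "(\<lambda>x. indicator {x. x \<noteq> 0 \<and> ennreal (norm x) < y \<and> sgn x \<in> A} (c *\<^sub>R x) :: ennreal) =
      indicator {x. x \<noteq> 0 \<and> norm x < 1 \<and> sgn x \<in> A}"
    using c by (auto simp: fun_eq_iff indicator_def sgn_scaleR ennreal_less_iff)
  also have "(\<integral>\<^sup>+x. indicator {x. x \<noteq> 0 \<and> norm x < 1 \<and> sgn x \<in> A} x \<partial>lborel) =
      emeasure lborel {x. x \<noteq> 0 \<and> norm x < 1 \<and> sgn x \<in> A}"
    by (subst nn_integral_indicator) auto
  also have "ennreal (\<bar>c\<bar> ^ CARD('n)) = y ^ CARD('n)"
    using c by (simp add: ennreal_power)
  finally show ?thesis .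
qed

text \<open>A simple radius splits the region into finitely many truncated cones, one for each value
  of \<open>g\<close>.\<close>

lemma polar_volume_simple:
  fixes g :: "real ^ 'n \<Rightarrow> ennreal"
  assumes g: "simple_function borel g" and fin: "\<And>x. g x < top"
  shows "(\<integral>\<^sup>+x. g (sgn x) ^ CARD('n) * indicator {x. x \<noteq> 0 \<and> norm x < 1} x \<partial>lborel) =
    emeasure lborel {x. x \<noteq> 0 \<and> ennreal (norm x) < g (sgn x)}"
proof -
  have R: "finite (range g)"
    using g by (simp add: simple_function_def)
  have [measurable]: "g \<in> borel_measurable borel"
    using g by (rule borel_measurable_simple_function)
  have lev[measurable]: "g -` {y} \<in> sets borel" for y
    using measurable_sets[of g borel borel "{y}"] by simp
  have "(\<integral>\<^sup>+x. g (sgn x) ^ CARD('n) * indicator {x. x \<noteq> 0 \<and> norm x < 1} x \<partial>lborel) =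
      (\<integral>\<^sup>+x. (\<Sum>y\<in>range g. y ^ CARD('n) * indicator {x. x \<noteq> 0 \<and> norm x < 1 \<and> sgn x \<in> g -` {y}} x) \<partial>lborel)"
  proof (rule nn_integral_cong)
    fix x :: "real ^ 'n"
    have "(\<Sum>y\<in>range g. y ^ CARD('n) * indicator {x. x \<noteq> 0 \<and> norm x < 1 \<and> sgn x \<in> g -` {y}} x) =
       (\<Sum>y\<in>range g. if y = g (sgn x) then g (sgn x) ^ CARD('n) * indicator {x. x \<noteq> 0 \<and> norm x < 1} x else (0::ennreal))"
      by (rule sum.cong) (auto simp: indicator_def)
    then show "g (sgn x) ^ CARD('n) * indicator {x. x \<noteq> 0 \<and> norm x < 1} x =
      (\<Sum>y\<in>range g. y ^ CARD('n) * indicator {x. x \<noteq> 0 \<and> norm x < 1 \<and> sgn x \<in> g -` {y}} x)"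
      using R by simp
  qed
  also have "\<dots> = (\<Sum>y\<in>range g. y ^ CARD('n) * emeasure lborel {x. x \<noteq> 0 \<and> norm x < 1 \<and> sgn x \<in> g -` {y}})"
    by (subst nn_integral_sum) (auto intro!: sum.cong nn_integral_cmult_indicator)
  also have "\<dots> = (\<Sum>y\<in>range g. emeasure lborel {x. x \<noteq> 0 \<and> ennreal (norm x) < y \<and> sgn x \<in> g -` {y}})"
    using fin by (intro sum.cong refl emeasure_truncated_cone[symmetric]) auto
  also have "\<dots> = emeasure lborel (\<Union>y\<in>range g. {x. x \<noteq> 0 \<and> ennreal (norm x) < y \<and> sgn x \<in> g -` {y}})"
    using R by (intro sum_emeasure) (auto simp: disjoint_family_on_def)
  also have "(\<Union>y\<in>range g. {x. x \<noteq> 0 \<and> ennreal (norm x) < y \<and> sgn x \<in> g -` {y}}) =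
      {x. x \<noteq> 0 \<and> ennreal (norm x) < g (sgn x)}"
    by auto
  finally show ?thesis .
qed

lemma tendsto_power_ennreal:
  fixes f :: "nat \<Rightarrow> ennreal"
  assumes "f \<longlonglongrightarrow> x" "x < top"
  shows "(\<lambda>i. f i ^ k) \<longlonglongrightarrow> x ^ k"
proof (induction k)
  case (Suc k)
  have "x ^ k < top"
    using assms(2) by (simp add: power_less_top_ennreal)
  then show ?case
    using Suc assms by (auto intro!: tendsto_mult_ennreal)
qed simp

text \<open>With the strict inequality, the regions of an increasing sequence of radii exhaust the
  region of their supremum exactly; a weak one would lose boundary points.\<close>

lemma polar_volume:
  fixes g :: "real ^ 'n \<Rightarrow> ennreal"
  assumes [measurable]: "g \<in> borel_measurable borel" and fin: "\<And>x. g x < top"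
  shows "(\<integral>\<^sup>+x. g (sgn x) ^ CARD('n) * indicator {x. x \<noteq> 0 \<and> norm x < 1} x \<partial>lborel) =
    emeasure lborel {x. x \<noteq> 0 \<and> ennreal (norm x) < g (sgn x)}"
proof -
  obtain f where f: "\<And>i. simple_function borel (f i)" "incseq f" "\<And>i x. f i x < top" "\<And>x. (SUP i. f i x) = g x"
    using borel_measurable_implies_simple_function_sequence'[OF assms(1)] by metis
  have [measurable]: "f i \<in> borel_measurable borel" for i
    using f(1) by (rule borel_measurable_simple_function)
  have lim: "(\<lambda>i. f i x) \<longlonglongrightarrow> g x" for x
    using LIMSEQ_SUP[of "\<lambda>i. f i x"] f(2,4) by (auto simp: incseq_def le_fun_def)
  have "(\<lambda>i. \<integral>\<^sup>+x. f i (sgn x) ^ CARD('n) * indicator {x. x \<noteq> 0 \<and> norm x < 1} x \<partial>lborel)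
      \<longlonglongrightarrow> (\<integral>\<^sup>+x. g (sgn x) ^ CARD('n) * indicator {x. x \<noteq> 0 \<and> norm x < 1} x \<partial>lborel)"
  proof (rule nn_integral_LIMSEQ)
    show "incseq (\<lambda>i x. f i (sgn x) ^ CARD('n) * indicator {x. x \<noteq> 0 \<and> norm x < 1} x)"
      using f(2) by (auto simp: incseq_def le_fun_def intro!: mult_right_mono power_mono)
    show "(\<lambda>i. f i (sgn x) ^ CARD('n) * indicator {x. x \<noteq> 0 \<and> norm x < 1} x) \<longlonglongrightarrow>
      g (sgn x) ^ CARD('n) * indicator {x. x \<noteq> 0 \<and> norm x < 1} x" for x
      using lim fin by (auto simp: indicator_def intro!: tendsto_power_ennreal)
  qed auto
  moreover have "(\<lambda>i. emeasure lborel {x. x \<noteq> 0 \<and> ennreal (norm x) < f i (sgn x)})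
      \<longlonglongrightarrow> emeasure lborel (\<Union>i. {x. x \<noteq> 0 \<and> ennreal (norm x) < f i (sgn x)})"
    using f(2) by (intro Lim_emeasure_incseq) (auto simp: incseq_def le_fun_def intro: less_le_trans)
  moreover have "(\<Union>i. {x. x \<noteq> 0 \<and> ennreal (norm x) < f i (sgn x)}) = {x. x \<noteq> 0 \<and> ennreal (norm x) < g (sgn x)}"
    by (auto simp: f(4)[symmetric] less_SUP_iff)
  ultimately show ?thesis
    using polar_volume_simple[OF f(1,3)] LIMSEQ_unique by fastforce
qed

section \<open>The cone measure on the sphere and its total mass\<close>

abbreviation ball_projection :: "(real ^ 'n) measure" where
  "ball_projection \<equiv> distr (restrict_space lborel (cball 0 1 - {0})) sphere_borel (\<lambda>x. x /\<^sub>R norm x)"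

text \<open>This is (1/n) \<rho>_Q^n du on Borel sets: the factor 1/n cancels the n in
  \<open>surface_measure\<close>, and no completion is taken, so that the measure can be compared
  with \<mu>.\<close>

definition cone_measure :: "(real ^ 'n) set \<Rightarrow> (real ^ 'n) measure" where
  "cone_measure Q = density ball_projection (\<lambda>u. ennreal (radial Q u ^ CARD('n)))"

lemma measurable_ball_projection:
  "(\<lambda>x. x /\<^sub>R norm x) \<in> measurable (restrict_space lborel (cball 0 1 - {0})) (sphere_borel :: (real ^ 'n) measure)"
proof (rule measurable_restrict_space2)
  show "(\<lambda>x. x /\<^sub>R norm x) \<in> space (restrict_space lborel (cball 0 1 - {0})) \<rightarrow> sphere 0 1"
    by (auto simp: space_restrict_space)
  show "(\<lambda>x. x /\<^sub>R norm x) \<in> borel_measurable (restrict_space lborel (cball 0 1 - {0}))"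
    by (rule measurable_restrict_space1) measurable
qed

lemma nn_integral_ball_projection:
  fixes f :: "real ^ 'n \<Rightarrow> ennreal"
  assumes "f \<in> borel_measurable sphere_borel"
  shows "(\<integral>\<^sup>+u. f u \<partial>ball_projection) =
    (\<integral>\<^sup>+x. f (sgn x) * indicator (cball 0 1 - {0}) x \<partial>lborel)"
  using assms
  by (simp add: nn_integral_distr[OF measurable_ball_projection] nn_integral_restrict_space sgn_div_norm)

text \<open>Measurability on \<open>sphere_borel\<close> says nothing about \<open>f\<close> off the
  sphere, and \<open>sgn 0\<close> is off the sphere; the indicator removes that point.\<close>

lemma borel_measurable_sgn_sphere:
  fixes f :: "real ^ 'n \<Rightarrow> ennreal"
  assumes "f \<in> borel_measurable sphere_borel"
  shows "(\<lambda>x. f (sgn x) * indicator (cball 0 1 - {0}) x) \<in> borel_measurable borel"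
proof -
  have "(\<lambda>x. f x * indicator (sphere 0 1) x) \<in> borel_measurable borel"
    using assms by (subst borel_measurable_restrict_space_iff_ennreal[symmetric]) auto
  moreover have "sgn \<in> borel_measurable (borel :: (real ^ 'n) measure)"
    by measurable
  ultimately have m: "(\<lambda>x. f (sgn x) * indicator (sphere 0 1) (sgn x)) \<in> borel_measurable borel"
    by (rule measurable_compose[rotated])
  have "(\<lambda>x. f (sgn x) * indicator (sphere 0 1) (sgn x) * indicator (cball 0 1 - {0}) x) \<in> borel_measurable borel"
    by (rule borel_measurable_times_ennreal[OF m], rule borel_measurable_indicator) auto
  then show ?thesis
    by (rule back_subst[of "\<lambda>f. f \<in> borel_measurable borel"]) (auto simp: indicator_def fun_eq_iff norm_sgn)
qed

lemma sets_cone_measure [simp, measurable_cong]: "sets (cone_measure Q) = sets sphere_borel"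
  by (simp add: cone_measure_def)

lemma space_cone_measure [simp]: "space (cone_measure Q) = sphere 0 1"
  by (simp add: cone_measure_def space_restrict_space)

lemma sphere_measurable_iff: "A \<in> sets sphere_borel \<longleftrightarrow> A \<in> sets borel \<and> A \<subseteq> sphere 0 1"
  by (subst sets_restrict_space_iff) auto

lemma star_body_radial_measurable:
  assumes "star_body Q"
  shows "radial Q \<in> borel_measurable sphere_borel"
  using assms by (auto simp: star_body_def intro!: borel_measurable_continuous_on_restrict)

lemma radial_greatest:
  assumes Q: "compact Q" "0 \<in> Q" and u: "norm u = 1"
  shows "radial Q u *\<^sub>R u \<in> Q" "\<And>l. l *\<^sub>R u \<in> Q \<Longrightarrow> l \<le> radial Q u"
proof -
  let ?L = "(\<lambda>l. l *\<^sub>R u) -` Q"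
  have "closed ?L"
    using Q(1) by (intro continuous_closed_vimage compact_imp_closed) auto
  moreover obtain B where B: "\<And>x. x \<in> Q \<Longrightarrow> norm x \<le> B"
    using compact_imp_bounded[OF Q(1)] by (auto simp: bounded_iff)
  then have "bounded ?L"
    using u by (auto simp: bounded_iff intro!: exI[of _ B]) (metis mult.right_neutral norm_scaleR real_norm_def)
  ultimately have "compact ?L"
    by (simp add: compact_eq_bounded_closed)
  moreover have "?L \<noteq> {}"
    using Q(2) by (metis empty_iff scaleR_zero_left vimageI)
  ultimately obtain m where m: "m *\<^sub>R u \<in> Q" "\<And>l. l *\<^sub>R u \<in> Q \<Longrightarrow> l \<le> m"
    using compact_attains_sup[of ?L] by auto
  then have "radial Q u = m"
    unfolding radial_def by (intro Greatest_equality) auto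
  with m show "radial Q u *\<^sub>R u \<in> Q" "\<And>l. l *\<^sub>R u \<in> Q \<Longrightarrow> l \<le> radial Q u"
    by auto
qed

lemma star_body_iff_radial:
  assumes Q: "star_body Q" and x: "x \<noteq> 0"
  shows "x \<in> Q \<longleftrightarrow> norm x \<le> radial Q (sgn x)"
proof -
  have c: "compact Q" "0 \<in> Q" "norm (sgn x) = 1" and seg: "\<And>y. y \<in> Q \<Longrightarrow> closed_segment 0 y \<subseteq> Q"
    using Q x by (auto simp: star_body_def norm_sgn)
  note g = radial_greatest[OF c]
  have xe: "norm x *\<^sub>R sgn x = x"
    using x by (simp add: sgn_div_norm)
  show ?thesis
  proof
    assume "x \<in> Q" then show "norm x \<le> radial Q (sgn x)"
      using g(2)[of "norm x"] xe by simp
  next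
    assume le: "norm x \<le> radial Q (sgn x)"
    have pos: "radial Q (sgn x) > 0"
      using le x zero_less_norm_iff[of x] by linarith
    have "x = (norm x / radial Q (sgn x)) *\<^sub>R (radial Q (sgn x) *\<^sub>R sgn x)"
      using pos by (simp add: xe)
    then have "x \<in> closed_segment 0 (radial Q (sgn x) *\<^sub>R sgn x)"
      unfolding closed_segment_def using le pos
      by (intro CollectI exI[of _ "norm x / radial Q (sgn x)"]) auto
    then show "x \<in> Q" using seg[OF g(1)] by blast
  qed
qed

text \<open>\<open>polar_volume\<close> measures the region where norm x is strictly below the
  radius, whereas Q has the weak inequality. Instead of showing that the boundary is null, Q is
  squeezed between the regions of radius \<rho>_Q and c \<rho>_Q with c > 1, and c tends to
  1.\<close>

lemma emeasure_cone_measure_sphere: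
  fixes Q :: "(real ^ 'n) set"
  assumes Q: "star_body Q"
  shows "emeasure (cone_measure Q) (sphere 0 1) = emeasure lborel Q"
proof -
  \<comment> \<open>Extension by 0 makes the radius a Borel function on the whole space, as
    \<open>polar_volume\<close> requires; \<open>c\<close> is the dilation used in the
    squeeze.\<close>
  define g where "g c x = (if x \<in> sphere 0 1 then ennreal (c * radial Q x) else 0)" for c and x :: "real ^ 'n"
  have [measurable]: "radial Q \<in> borel_measurable sphere_borel"
    by (rule star_body_radial_measurable[OF Q])
  have gm[measurable]: "g c \<in> borel_measurable borel" for c
  proof -
    have "(\<lambda>x. ennreal (c * radial Q x) * indicator (sphere 0 1) x) \<in> borel_measurable borel"
      by (rule borel_measurable_restrict_space_iff_ennreal[THEN iffD1]) auto
    moreover have "g c = (\<lambda>x. ennreal (c * radial Q x) * indicator (sphere 0 1) x)"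
      by (auto simp: g_def fun_eq_iff indicator_def)
    ultimately show ?thesis by (simp only:)
  qed
  define k where "k = emeasure (cone_measure Q) (sphere 0 1)"
  have ke: "k = (\<integral>\<^sup>+x. g 1 (sgn x) ^ CARD('n) * indicator {x. x \<noteq> 0 \<and> norm x < 1} x \<partial>lborel)"
  proof -
    have "sphere 0 1 \<in> sets (ball_projection :: (real ^ 'n) measure)"
      by (simp add: sphere_measurable_iff)
    then have "k = (\<integral>\<^sup>+u. ennreal (radial Q u ^ CARD('n)) * indicator (sphere 0 1) u \<partial>ball_projection)"
      unfolding k_def cone_measure_def
      by (intro emeasure_density) (auto simp: space_restrict_space)
    also have "\<dots> = (\<integral>\<^sup>+x. ennreal (radial Q (sgn x) ^ CARD('n)) * indicator (sphere 0 1) (sgn x) * indicator (cball 0 1 - {0}) x \<partial>lborel)"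
    proof (rule nn_integral_ball_projection)
      have [measurable]: "sphere 0 1 \<in> sets (sphere_borel :: (real ^ 'n) measure)"
        by (simp add: sphere_measurable_iff)
      show "(\<lambda>u. ennreal (radial Q u ^ CARD('n)) * indicator (sphere 0 1) u) \<in> borel_measurable sphere_borel"
        by measurable
    qed
    also have "\<dots> = (\<integral>\<^sup>+x. g 1 (sgn x) ^ CARD('n) * indicator {x. x \<noteq> 0 \<and> norm x < 1} x \<partial>lborel)"
    proof (rule nn_integral_cong_AE)
      have "sphere (0 :: real ^ 'n) 1 \<in> null_sets lborel"
        using negligible_sphere[of "0 :: real ^ 'n" 1] by (simp add: negligible_iff_null_sets null_sets_completion_iff)
      then have "AE x in lborel. x \<notin> sphere (0 :: real ^ 'n) 1"
        by (rule AE_not_in)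
      then show "AE x in lborel. ennreal (radial Q (sgn x) ^ CARD('n)) * indicator (sphere 0 1) (sgn x) * indicator (cball 0 1 - {0}) x
          = g 1 (sgn x) ^ CARD('n) * indicator {x. x \<noteq> 0 \<and> norm x < 1} x"
      proof eventually_elim
        case (elim x)
        have "radial Q (sgn x) > 0" if "x \<noteq> 0"
          using Q that by (auto simp: star_body_def norm_sgn)
        then show ?case
          using elim by (auto simp: g_def indicator_def norm_sgn ennreal_power)
      qed
    qed
    finally show ?thesis .
  qed
  have vol: "emeasure lborel {x. x \<noteq> 0 \<and> ennreal (norm x) < g c (sgn x)} = ennreal (c ^ CARD('n)) * k" if "c > 0" for c
  proof -
    have "emeasure lborel {x. x \<noteq> 0 \<and> ennreal (norm x) < g c (sgn x)} =
      (\<integral>\<^sup>+x. g c (sgn x) ^ CARD('n) * indicator {x. x \<noteq> 0 \<and> norm x < 1} x \<partial>lborel)"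
      by (rule polar_volume[symmetric, OF gm]) (simp add: g_def)
    also have "\<dots> = (\<integral>\<^sup>+x. ennreal (c ^ CARD('n)) * (g 1 (sgn x) ^ CARD('n) * indicator {x. x \<noteq> 0 \<and> norm x < 1} x) \<partial>lborel)"
      using that by (intro nn_integral_cong)
        (auto simp: g_def indicator_def norm_sgn ennreal_mult' power_mult_distrib ennreal_power[symmetric])
    also have "\<dots> = ennreal (c ^ CARD('n)) * k"
      unfolding ke by (rule nn_integral_cmult) measurable
    finally show ?thesis .
  qed
  have [measurable]: "Q \<in> sets borel"
    using Q by (auto simp: star_body_def intro: borel_compact)
  have Q0: "emeasure lborel (Q - {0}) = emeasure lborel Q"
    by (intro emeasure_Diff_null_set) auto
  have pos: "x \<noteq> 0 \<Longrightarrow> radial Q (sgn x) > 0" for x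
    using Q by (auto simp: star_body_def norm_sgn)
  have "k \<le> emeasure lborel Q"
  proof -
    have "k = emeasure lborel {x. x \<noteq> 0 \<and> ennreal (norm x) < g 1 (sgn x)}"
      by (simp add: vol)
    also have "\<dots> \<le> emeasure lborel Q"
      by (rule emeasure_mono)
        (auto simp: star_body_iff_radial[OF Q] g_def ennreal_less_iff norm_sgn)
    finally show ?thesis .
  qed
  moreover have le: "emeasure lborel Q \<le> ennreal (c ^ CARD('n)) * k" if "c > 1" for c
  proof -
    have "emeasure lborel (Q - {0}) \<le> emeasure lborel {x. x \<noteq> 0 \<and> ennreal (norm x) < g c (sgn x)}"
    proof (rule emeasure_mono, safe)
      fix x assume x: "x \<in> Q" "x \<noteq> 0"
      have "norm x \<le> radial Q (sgn x)"
        using x star_body_iff_radial[OF Q] by auto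
      also have "\<dots> < c * radial Q (sgn x)"
        using pos[OF x(2)] that by simp
      finally show "ennreal (norm x) < g c (sgn x)"
        using x by (simp add: g_def norm_sgn ennreal_less_iff)
    qed measurable
    then show ?thesis using that Q0 by (simp add: vol)
  qed
  have "emeasure lborel Q \<le> k"
  proof -
    have "k < top"
      using \<open>k \<le> _\<close> emeasure_compact_finite[of Q] Q by (auto simp: star_body_def)
    have "(\<lambda>i. ennreal ((1 + 1 / Suc i) ^ CARD('n))) \<longlonglongrightarrow> ennreal ((1 + 0) ^ CARD('n))"
      by (intro tendsto_ennrealI tendsto_intros LIMSEQ_Suc[OF lim_1_over_n])
    then have "(\<lambda>i. k * ennreal ((1 + 1 / Suc i) ^ CARD('n))) \<longlonglongrightarrow> k * ennreal ((1 + 0) ^ CARD('n))"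
      by (intro ennreal_tendsto_cmult \<open>k < top\<close>)
    moreover have "emeasure lborel Q \<le> k * ennreal ((1 + 1 / Suc i) ^ CARD('n))" for i
      using le[of "1 + 1 / Suc i"] by (simp add: mult.commute)
    ultimately show ?thesis
      by (intro LIMSEQ_le_const[where X = "\<lambda>i. k * ennreal ((1 + 1 / Suc i) ^ CARD('n))"]) auto
  qed
  ultimately show ?thesis unfolding k_def by simp
qed


text \<open>By \<open>cone\<close> the radial preimage of the trace of B on the sphere lies in B. In
  this way hyperplanes and kinks, known to be null in the full space, become null on the
  sphere.\<close>

lemma null_sets_ball_projection:
  fixes B :: "(real ^ 'n) set"
  assumes B: "B \<in> null_sets lborel" and cone: "\<And>x. sgn x \<in> B \<Longrightarrow> x \<in> B"
  shows "B \<inter> sphere 0 1 \<in> null_sets ball_projection"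
proof -
  have [measurable]: "B \<in> sets borel" using B by auto
  have BS: "B \<inter> sphere 0 1 \<in> sets (sphere_borel :: (real ^ 'n) measure)"
    by (simp add: sphere_measurable_iff)
  have "emeasure ball_projection (B \<inter> sphere 0 1) = (\<integral>\<^sup>+u. indicator (B \<inter> sphere 0 1) u \<partial>ball_projection)"
    using BS by (intro nn_integral_indicator[symmetric]) simp
  also have "\<dots> = (\<integral>\<^sup>+x. indicator (B \<inter> sphere 0 1) (sgn x) * indicator (cball 0 1 - {0}) x \<partial>lborel)"
    using BS by (intro nn_integral_ball_projection borel_measurable_indicator)
  also have "\<dots> \<le> (\<integral>\<^sup>+x. indicator B x \<partial>lborel)"
    using cone by (intro nn_integral_mono) (auto simp: indicator_def)
  also have "\<dots> = 0"
    using B by (simp add: null_sets_def)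
  finally show ?thesis
    using BS by (auto simp: null_sets_def)
qed

section \<open>From the surface measure to the cone measure\<close>

lemma surface_measure_eq: "surface_measure = completion (scale_measure (of_nat CARD('n)) (ball_projection :: (real ^ 'n) measure))"
  by (simp add: surface_measure_def)

lemma null_sets_surface_measure:
  fixes N :: "(real ^ 'n) set"
  assumes "N \<in> null_sets ball_projection"
  shows "N \<in> null_sets surface_measure"
  unfolding surface_measure_eq using assms by (intro null_sets_completionI) (auto simp: null_sets_def)

lemma null_sets_cone_measure:
  fixes N :: "(real ^ 'n) set"
  assumes "star_body Q" "N \<in> null_sets ball_projection"
  shows "N \<in> null_sets (cone_measure Q)"
  using star_body_radial_measurable[OF assms(1)] assms(2) unfolding cone_measure_def
  by (subst null_sets_density_iff) (auto intro: AE_I')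

lemma nn_integral_surface_measure:
  fixes f :: "real ^ 'n \<Rightarrow> ennreal"
  assumes "f \<in> borel_measurable sphere_borel"
  shows "(\<integral>\<^sup>+u. f u \<partial>surface_measure) = of_nat CARD('n) * (\<integral>\<^sup>+u. f u \<partial>ball_projection)"
  unfolding surface_measure_eq nn_integral_completion
  using assms by (intro nn_integral_scale_measure) simp

lemma nn_integral_surface_measure_radial:
  fixes Q :: "(real ^ 'n) set"
  assumes Q: "star_body Q" and A: "A \<in> sets sphere_borel"
  shows "ennreal (1 / CARD('n)) * (\<integral>\<^sup>+u\<in>A. ennreal (radial Q u ^ CARD('n)) \<partial>surface_measure) =
    emeasure (cone_measure Q) A"
proof -
  note [measurable] = star_body_radial_measurable[OF Q] A
  have "(\<integral>\<^sup>+u\<in>A. ennreal (radial Q u ^ CARD('n)) \<partial>surface_measure) =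
      of_nat CARD('n) * (\<integral>\<^sup>+u\<in>A. ennreal (radial Q u ^ CARD('n)) \<partial>ball_projection)"
    by (rule nn_integral_surface_measure) measurable
  also have "(\<integral>\<^sup>+u\<in>A. ennreal (radial Q u ^ CARD('n)) \<partial>ball_projection) = emeasure (cone_measure Q) A"
    unfolding cone_measure_def using A star_body_radial_measurable[OF Q] by (intro emeasure_density[symmetric]) auto
  finally show ?thesis
    by (simp add: mult.assoc[symmetric] ennreal_of_nat_eq_real_of_nat ennreal_mult'[symmetric])
qed

text \<open>The reverse radial Gauss image of a Borel set is not known to be Borel. The integral
  does not see changes on a null set, so a Borel set \<open>A\<close> that agrees with it off
  \<open>N\<close> may take its place.\<close>

lemma dual_curvature_0_eq_cone_measure:
  fixes Q K :: "(real ^ 'n) set"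
  assumes Q: "star_body Q" and A: "A \<in> sets sphere_borel" and N: "N \<in> null_sets ball_projection"
    and eq: "\<And>u. u \<in> sphere 0 1 - N \<Longrightarrow> u \<in> reverse_radial_Gauss_image K \<eta> \<longleftrightarrow> u \<in> A"
  shows "dual_curvature_0 K Q \<eta> = emeasure (cone_measure Q) A"
proof -
  have sp: "space surface_measure = (sphere 0 1 :: (real ^ 'n) set)"
    by (simp add: surface_measure_eq space_scale_measure space_restrict_space)
  have "AE u in surface_measure. u \<notin> N"
    by (rule AE_not_in[OF null_sets_surface_measure[OF N]])
  then have "(\<integral>\<^sup>+u\<in>reverse_radial_Gauss_image K \<eta>. ennreal (radial Q u ^ CARD('n)) \<partial>surface_measure) =
    (\<integral>\<^sup>+u\<in>A. ennreal (radial Q u ^ CARD('n)) \<partial>surface_measure)"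
    by (intro nn_integral_cong_AE, elim AE_mp, intro AE_I2) (auto simp: indicator_def eq sp)
  then show ?thesis
    unfolding dual_curvature_0_def using nn_integral_surface_measure_radial[OF Q A] by simp
qed

text \<open>If the image contained the trace of \<open>U\<close>, that trace would have cone measure
  0, although the cone over it has a nonempty open part and \<rho>_Q is positive. The image enters
  only through monotonicity of the integral, which asks for no measurability.\<close>

lemma reverse_radial_Gauss_image_misses_open:
  fixes Q K :: "(real ^ 'n) set"
  assumes Q: "star_body Q" and 0: "dual_curvature_0 K Q \<eta> = 0"
    and U: "open U" "w \<in> U" "norm w = 1"
  obtains u where "u \<in> U" "norm u = 1" "u \<notin> reverse_radial_Gauss_image K \<eta>"
proof (rule ccontr)
  assume "\<not> thesis"
  with that have "u \<in> reverse_radial_Gauss_image K \<eta>" if "u \<in> U" "norm u = 1" for u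
    using that by blast
  then have sub: "U \<inter> sphere 0 1 \<subseteq> reverse_radial_Gauss_image K \<eta>" by auto
  have [measurable]: "U \<in> sets borel" using U(1) by simp
  have A[measurable]: "U \<inter> sphere 0 1 \<in> sets (sphere_borel :: (real ^ 'n) measure)"
    by (simp add: sphere_measurable_iff)
  note [measurable] = star_body_radial_measurable[OF Q]
  have "emeasure (cone_measure Q) (U \<inter> sphere 0 1) \<le> dual_curvature_0 K Q \<eta>"
    unfolding nn_integral_surface_measure_radial[OF Q A, symmetric] dual_curvature_0_def
    using sub by (intro mult_left_mono nn_integral_mono) (auto simp: indicator_def)
  then have "(\<integral>\<^sup>+u. ennreal (radial Q u ^ CARD('n)) * indicator (U \<inter> sphere 0 1) u \<partial>ball_projection) = 0"
    using A star_body_radial_measurable[OF Q] 0 unfolding cone_measure_def by (subst (asm) emeasure_density) auto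
  then have "(\<integral>\<^sup>+x. ennreal (radial Q (sgn x) ^ CARD('n)) * indicator (U \<inter> sphere 0 1) (sgn x) * indicator (cball 0 1 - {0}) x \<partial>lborel) = 0"
    by (subst (asm) nn_integral_ball_projection) measurable
  moreover have "(\<lambda>x. ennreal (radial Q (sgn x) ^ CARD('n)) * indicator (U \<inter> sphere 0 1) (sgn x) * indicator (cball 0 1 - {0}) x)
      \<in> borel_measurable borel"
    by (rule borel_measurable_sgn_sphere) measurable
  ultimately have ae: "AE x in lborel. ennreal (radial Q (sgn x) ^ CARD('n)) * indicator (U \<inter> sphere 0 1) (sgn x) * indicator (cball 0 1 - {0}) x = 0"
    by (subst (asm) nn_integral_0_iff_AE) auto
  define V where "V = (ball 0 1 - {0}) \<inter> (\<lambda>x. x /\<^sub>R norm x) -` U"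
  have "open V"
    unfolding V_def by (intro continuous_open_preimage continuous_intros) (auto simp: U)
  moreover have "(1/2) *\<^sub>R w \<in> V"
    using U by (auto simp: V_def)
  ultimately have "\<not> negligible V"
    using open_not_negligible by blast
  moreover have "AE x in lborel. x \<notin> V"
    using ae
  proof eventually_elim
    case (elim x)
    have "radial Q (sgn x) > 0" if "x \<noteq> 0"
      using Q that by (auto simp: star_body_def norm_sgn)
    then show ?case
      using elim by (auto simp: V_def indicator_def sgn_div_norm norm_sgn split: if_splits)
  qed
  then have "V \<in> null_sets lborel"
    using \<open>open V\<close> by (subst (asm) AE_iff_null_sets[symmetric]) auto
  ultimately show False
    by (simp add: negligible_iff_null_sets null_sets_completionI)
qed

section \<open>Evenness and finiteness of the cone measure\<close>

lemma radial_uminus: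
  assumes "origin_symmetric Q"
  shows "radial Q (- u) = radial Q u"
proof -
  have "- x \<in> Q \<longleftrightarrow> x \<in> Q" for x
    using assms unfolding origin_symmetric_def by (metis (no_types, lifting) imageE image_eqI minus_minus)
  from this[of "l *\<^sub>R u" for l] show ?thesis
    unfolding radial_def by simp
qed

lemma nn_integral_lborel_uminus:
  fixes f :: "'a::euclidean_space \<Rightarrow> ennreal"
  assumes "f \<in> borel_measurable borel"
  shows "(\<integral>\<^sup>+x. f (- x) \<partial>lborel) = (\<integral>\<^sup>+x. f x \<partial>lborel)"
  using nn_integral_lborel_scale[OF assms, of "-1"] by simp

lemma sphere_borel_uminus: "uminus \<in> measurable sphere_borel (sphere_borel :: (real ^ 'n) measure)"
  by (intro measurable_restrict_space2 measurable_restrict_space1) (auto simp: space_restrict_space)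

text \<open>Seen through \<open>sgn\<close> on the ball, the antipodal map of the sphere becomes the
  reflection of the space, which preserves Lebesgue measure.\<close>

lemma even_cone_measure:
  fixes Q :: "(real ^ 'n) set"
  assumes Q: "star_body Q" and sym: "origin_symmetric Q"
  shows "distr (cone_measure Q) sphere_borel uminus = cone_measure Q"
proof (rule measure_eqI)
  note [measurable] = star_body_radial_measurable[OF Q] sphere_borel_uminus
  fix A assume "A \<in> sets (distr (cone_measure Q) sphere_borel uminus)"
  then have A[measurable]: "A \<in> sets sphere_borel" by simp
  define f where "f u = ennreal (radial Q u ^ CARD('n)) * indicator A u" for u
  have fm[measurable]: "f \<in> borel_measurable sphere_borel" unfolding f_def by measurable
  have A': "uminus -` A \<inter> sphere 0 1 \<in> sets sphere_borel"
    using measurable_sets[OF sphere_borel_uminus A] by (simp add: space_restrict_space)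
  have c: "emeasure (cone_measure Q) B = (\<integral>\<^sup>+u. ennreal (radial Q u ^ CARD('n)) * indicator B u \<partial>ball_projection)"
    if "B \<in> sets sphere_borel" for B
    unfolding cone_measure_def using that star_body_radial_measurable[OF Q] by (intro emeasure_density) auto
  have gm: "(\<lambda>x. f (sgn x) * indicator (cball 0 1 - {0}) x) \<in> borel_measurable borel"
    by (rule borel_measurable_sgn_sphere) measurable
  have "emeasure (distr (cone_measure Q) sphere_borel uminus) A = emeasure (cone_measure Q) (uminus -` A \<inter> sphere 0 1)"
    by (subst emeasure_distr) (auto intro: A)
  also have "\<dots> = (\<integral>\<^sup>+u. f (- u) \<partial>ball_projection)"
    unfolding c[OF A'] by (intro nn_integral_cong) (auto simp: f_def radial_uminus[OF sym] indicator_def space_restrict_space)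
  also have "\<dots> = (\<integral>\<^sup>+x. f (- sgn x) * indicator (cball 0 1 - {0}) x \<partial>lborel)"
    by (rule nn_integral_ball_projection) measurable
  also have "\<dots> = (\<integral>\<^sup>+x. f (sgn (- x)) * indicator (cball 0 1 - {0}) (- x) \<partial>lborel)"
    by (intro nn_integral_cong) (auto simp: sgn_minus indicator_def)
  also have "\<dots> = (\<integral>\<^sup>+x. f (sgn x) * indicator (cball 0 1 - {0}) x \<partial>lborel)"
    by (rule nn_integral_lborel_uminus[OF gm])
  also have "\<dots> = (\<integral>\<^sup>+u. f u \<partial>ball_projection)"
    by (rule nn_integral_ball_projection[symmetric]) measurable
  also have "\<dots> = emeasure (cone_measure Q) A"
    unfolding c[OF A] f_def by simp
  finally show "emeasure (distr (cone_measure Q) sphere_borel uminus) A = emeasure (cone_measure Q) A" .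
qed simp

lemma finite_cone_measure:
  assumes "star_body Q"
  shows "finite_measure (cone_measure Q)"
  using emeasure_cone_measure_sphere[OF assms] assms emeasure_compact_finite[of Q]
  by (intro finite_measureI) (auto simp: star_body_def)

section \<open>The conjugate norm\<close>

text \<open>Its logarithm is a Legendre-type conjugate, the maximum over v of ln |x.v| - \<phi>(v).
  The multiplicative form avoids ln 0 and is a norm in \<open>x\<close>.\<close>

definition conj_norm :: "('a::euclidean_space \<Rightarrow> real) \<Rightarrow> 'a \<Rightarrow> real" where
  "conj_norm \<phi> x = (SUP v\<in>sphere 0 1. \<bar>x \<bullet> v\<bar> * exp (- \<phi> v))"

context
  fixes \<phi> :: "'a::euclidean_space \<Rightarrow> real"
  assumes \<phi>: "continuous_on (sphere 0 1) \<phi>"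
begin

lemma conj_norm_attained:
  obtains v where "norm v = 1" "conj_norm \<phi> x = \<bar>x \<bullet> v\<bar> * exp (- \<phi> v)"
    "\<And>w. norm w = 1 \<Longrightarrow> \<bar>x \<bullet> w\<bar> * exp (- \<phi> w) \<le> \<bar>x \<bullet> v\<bar> * exp (- \<phi> v)"
proof -
  let ?f = "\<lambda>v. \<bar>x \<bullet> v\<bar> * exp (- \<phi> v)"
  have "continuous_on (sphere 0 1) ?f"
    by (intro continuous_intros \<phi>)
  then obtain v where v: "v \<in> sphere 0 1" "\<And>w. w \<in> sphere 0 1 \<Longrightarrow> ?f w \<le> ?f v"
    using continuous_attains_sup[of "sphere 0 1" ?f] by auto
  then have "conj_norm \<phi> x = ?f v"
    unfolding conj_norm_def by (intro cSup_eq_maximum) auto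
  with v show thesis by (intro that[of v]) auto
qed

lemma conj_norm_upper: "norm v = 1 \<Longrightarrow> \<bar>x \<bullet> v\<bar> * exp (- \<phi> v) \<le> conj_norm \<phi> x"
  by (metis conj_norm_attained)

lemma conj_norm_scaleR: "conj_norm \<phi> (c *\<^sub>R x) = \<bar>c\<bar> * conj_norm \<phi> x"
proof (rule antisym)
  obtain v where "norm v = 1" "conj_norm \<phi> (c *\<^sub>R x) = \<bar>c *\<^sub>R x \<bullet> v\<bar> * exp (- \<phi> v)"
    by (rule conj_norm_attained)
  then show "conj_norm \<phi> (c *\<^sub>R x) \<le> \<bar>c\<bar> * conj_norm \<phi> x"
    using conj_norm_upper[of v x] by (simp add: abs_mult mult.assoc mult_left_mono)
next
  obtain v where "norm v = 1" "conj_norm \<phi> x = \<bar>x \<bullet> v\<bar> * exp (- \<phi> v)"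
    by (rule conj_norm_attained)
  then show "\<bar>c\<bar> * conj_norm \<phi> x \<le> conj_norm \<phi> (c *\<^sub>R x)"
    using conj_norm_upper[of v "c *\<^sub>R x"] by (simp add: abs_mult mult.assoc)
qed

lemma conj_norm_0 [simp]: "conj_norm \<phi> 0 = 0"
  using conj_norm_scaleR[of 0 0] by simp

lemma conj_norm_uminus [simp]: "conj_norm \<phi> (- x) = conj_norm \<phi> x"
  using conj_norm_scaleR[of "-1" x] by simp

lemma conj_norm_triangle: "conj_norm \<phi> (x + y) \<le> conj_norm \<phi> x + conj_norm \<phi> y"
proof -
  obtain v where v: "norm v = 1" "conj_norm \<phi> (x + y) = \<bar>(x + y) \<bullet> v\<bar> * exp (- \<phi> v)"
    by (rule conj_norm_attained)
  have "\<bar>(x + y) \<bullet> v\<bar> * exp (- \<phi> v) \<le> (\<bar>x \<bullet> v\<bar> + \<bar>y \<bullet> v\<bar>) * exp (- \<phi> v)"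
    by (intro mult_right_mono) (auto simp: inner_add_left)
  with v conj_norm_upper[OF v(1), of x] conj_norm_upper[OF v(1), of y] show ?thesis
    by (simp add: distrib_right)
qed

lemma conj_norm_le_norm:
  assumes "\<And>v. norm v = 1 \<Longrightarrow> exp (- \<phi> v) \<le> M"
  shows "conj_norm \<phi> x \<le> M * norm x"
proof -
  obtain v where v: "norm v = 1" "conj_norm \<phi> x = \<bar>x \<bullet> v\<bar> * exp (- \<phi> v)"
    by (rule conj_norm_attained)
  have "\<bar>x \<bullet> v\<bar> * exp (- \<phi> v) \<le> norm x * M"
    using Cauchy_Schwarz_ineq2[of x v] v(1) assms[OF v(1)] by (intro mult_mono) auto
  with v show ?thesis by (simp add: mult.commute)
qed

lemma conj_norm_ge_norm:
  assumes "x \<noteq> 0"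
  shows "norm x * exp (- \<phi> (sgn x)) \<le> conj_norm \<phi> x"
proof -
  have "x \<bullet> sgn x = norm x"
    using assms by (simp add: sgn_div_norm dot_square_norm power2_eq_square)
  then show ?thesis
    using conj_norm_upper[of "sgn x" x] assms by (simp add: norm_sgn)
qed

lemma conj_norm_pos: "x \<noteq> 0 \<Longrightarrow> 0 < conj_norm \<phi> x"
  using conj_norm_ge_norm[of x] by (smt (verit) exp_gt_zero mult_pos_pos zero_less_norm_iff)

lemma conj_norm_diff: "\<bar>conj_norm \<phi> x - conj_norm \<phi> y\<bar> \<le> conj_norm \<phi> (x - y)"
  using conj_norm_triangle[of "x - y" y] conj_norm_triangle[of "y - x" x] conj_norm_uminus[of "x - y"]
  by simp

lemma conj_norm_bound:
  obtains M where "M > 0" "\<And>x. conj_norm \<phi> x \<le> M * norm x"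
proof -
  have "compact ((\<lambda>v. exp (- \<phi> v)) ` sphere 0 1)"
    by (intro compact_continuous_image continuous_intros \<phi>) auto
  then have "bounded ((\<lambda>v. exp (- \<phi> v)) ` sphere 0 1)"
    by (rule compact_imp_bounded)
  then obtain M where M: "M > 0" "\<forall>y\<in>(\<lambda>v. exp (- \<phi> v)) ` sphere 0 1. norm y \<le> M"
    unfolding bounded_pos by blast
  then have "exp (- \<phi> v) \<le> M" if "norm v = 1" for v
    using that by auto
  then show thesis
    using M(1) by (intro that[of M] conj_norm_le_norm)
qed

lemma continuous_on_conj_norm: "continuous_on A (conj_norm \<phi>)"
proof -
  obtain M where M: "M > 0" "\<And>x. conj_norm \<phi> x \<le> M * norm x"
    using conj_norm_bound by blast
  have "M-lipschitz_on A (conj_norm \<phi>)"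
  proof (rule lipschitz_onI)
    show "dist (conj_norm \<phi> x) (conj_norm \<phi> y) \<le> M * dist x y" for x y
      using conj_norm_diff[of x y] M(2)[of "x - y"] by (simp add: dist_norm)
  qed (use M in simp)
  then show ?thesis by (rule lipschitz_on_continuous_on)
qed

lemma continuous_on_ln_conj_norm: "continuous_on (sphere 0 1) (\<lambda>u. ln (conj_norm \<phi> u))"
  by (intro continuous_intros continuous_on_conj_norm ballI less_imp_neq[symmetric] conj_norm_pos) auto

text \<open>The double conjugate lies below the function, in exponential form: |u.v| \<le>
  N_\<phi>(u) exp \<phi>(v) can be solved for either factor.\<close>

lemma conj_norm_biconj:
  assumes v: "norm v = 1"
  shows "conj_norm (\<lambda>u. ln (conj_norm \<phi> u)) v \<le> exp (\<phi> v)"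
proof (subst conj_norm_def, rule cSUP_least)
  show "\<bar>v \<bullet> u\<bar> * exp (- ln (conj_norm \<phi> u)) \<le> exp (\<phi> v)" if u: "u \<in> sphere 0 1" for u
  proof -
    have pos: "0 < conj_norm \<phi> u"
      using u by (intro conj_norm_pos) auto
    have "\<bar>v \<bullet> u\<bar> \<le> conj_norm \<phi> u * exp (\<phi> v)"
      using conj_norm_upper[OF v, of u] by (simp add: exp_minus field_simps inner_commute)
    then show ?thesis
      using pos by (simp add: exp_minus field_simps)
  qed
qed simp

end

text \<open>Conjugation reverses order and turns the addition of a constant into its subtraction.
  With a free real \<open>d\<close> this covers shifts of either sign and the sup-norm estimate at
  once.\<close>

lemma conj_norm_mono:
  assumes "continuous_on (sphere 0 1) \<phi>" "continuous_on (sphere 0 1) \<psi>"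
    and le: "\<And>v. norm v = 1 \<Longrightarrow> \<phi> v \<le> \<psi> v + d"
  shows "conj_norm \<psi> x \<le> exp d * conj_norm \<phi> x"
proof -
  obtain v where v: "norm v = 1" "conj_norm \<psi> x = \<bar>x \<bullet> v\<bar> * exp (- \<psi> v)"
    using conj_norm_attained[OF assms(2)] by metis
  have "exp (- \<psi> v) \<le> exp d * exp (- \<phi> v)"
    using le[OF v(1)] by (simp add: mult_exp_exp)
  then have "\<bar>x \<bullet> v\<bar> * exp (- \<psi> v) \<le> exp d * (\<bar>x \<bullet> v\<bar> * exp (- \<phi> v))"
    by (metis abs_ge_zero mult.left_commute mult_left_mono)
  also have "\<dots> \<le> exp d * conj_norm \<phi> x"
    using conj_norm_upper[OF assms(1) v(1)] by simp
  finally show ?thesis using v by simp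
qed

lemma ln_conj_norm_mono:
  assumes "continuous_on (sphere 0 1) \<phi>" "continuous_on (sphere 0 1) \<psi>"
    and "\<And>v. norm v = 1 \<Longrightarrow> \<phi> v \<le> \<psi> v + d" and u: "norm u = 1"
  shows "ln (conj_norm \<psi> u) \<le> d + ln (conj_norm \<phi> u)"
proof -
  have u0: "u \<noteq> 0" using u by auto
  have "ln (conj_norm \<psi> u) \<le> ln (exp d * conj_norm \<phi> u)"
    using conj_norm_mono[OF assms(1-3), of u] conj_norm_pos[OF assms(2) u0] conj_norm_pos[OF assms(1) u0]
    by (subst ln_le_cancel_iff) auto
  also have "\<dots> = d + ln (conj_norm \<phi> u)"
    using conj_norm_pos[OF assms(1) u0] by (simp add: ln_mult)
  finally show ?thesis .
qed

section \<open>Kinks of Lipschitz convex functions\<close>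

lemma nn_integral_lborel_translation:
  fixes f :: "'a::euclidean_space \<Rightarrow> ennreal"
  assumes [measurable]: "f \<in> borel_measurable borel"
  shows "(\<integral>\<^sup>+x. f (a + x) \<partial>lborel) = (\<integral>\<^sup>+x. f x \<partial>lborel)"
  by (subst (2) lborel_distr_plus[of a, symmetric]) (simp add: nn_integral_distr)

text \<open>The second differences at m consecutive points on a line in direction e, at distance t = 1/m,
  telescope and add up to at most 2 L t |e|, whereas each of them integrates to at least c t vol over
  the corresponding translate of the set.\<close>

lemma null_sets_kinks:
  fixes N :: "'a::euclidean_space \<Rightarrow> real"
  assumes conv: "\<And>x h. 2 * N x \<le> N (x + h) + N (x - h)"
    and lip: "\<And>x y. \<bar>N x - N y\<bar> \<le> L * norm (x - y)" and c: "c > 0"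
  shows "{x. \<forall>t>0. c * t \<le> N (x + t *\<^sub>R e) + N (x - t *\<^sub>R e) - 2 * N x} \<in> null_sets lborel"
    (is "?B \<in> _")
proof -
  define D where "D t x = N (x + t *\<^sub>R e) + N (x - t *\<^sub>R e) - 2 * N x" for t x
  have L0: "0 \<le> L"
  proof -
    obtain b :: 'a where "b \<in> Basis" using nonempty_Basis by blast
    then show ?thesis using lip[of b 0] by simp
  qed
  have "L-lipschitz_on UNIV N"
    using lip L0 by (intro lipschitz_onI) (auto simp: dist_norm)
  then have N: "continuous_on UNIV N" by (rule lipschitz_on_continuous_on)
  have cont: "continuous_on UNIV (\<lambda>x. N (f x))" if "continuous_on UNIV f" for f :: "'a \<Rightarrow> 'a"
    using continuous_on_compose2[OF N that] by auto
  have Dc: "continuous_on UNIV (\<lambda>x. D t x)" for t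
    unfolding D_def by (intro continuous_intros cont)
  then have [measurable]: "D t \<in> borel_measurable borel" for t
    by (rule borel_measurable_continuous_onI)
  \<comment> \<open>Uncountably many conditions on x, but each is closed by continuity, and so is
    their intersection.\<close>
  have "?B = (\<Inter>t\<in>{0<..}. {x. c * t \<le> D t x})"
    by (auto simp: D_def)
  also have "closed \<dots>"
    by (intro closed_INT ballI closed_Collect_le continuous_intros Dc)
  finally have [measurable]: "?B \<in> sets borel" by simp
  have D0: "0 \<le> D t x" for t x
    using conv[of x "t *\<^sub>R e"] by (simp add: D_def)
  have tele: "(\<Sum>k<m. D t (real k *\<^sub>R t *\<^sub>R e + x)) =
    (N (x + real m *\<^sub>R t *\<^sub>R e) - N (x + real m *\<^sub>R t *\<^sub>R e - t *\<^sub>R e)) - (N x - N (x - t *\<^sub>R e))" for m t x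
    by (induction m) (auto simp: D_def algebra_simps scaleR_add_left)
  have zero: "?B \<inter> cball 0 R \<in> null_sets lborel" for R
  proof -
    define A where "A = ?B \<inter> cball 0 R"
    \<comment> \<open>Every x for which some k t \<le> 1 puts k t e + x into A lies in this ball, so
      one region serves all the translates.\<close>
    define C where "C = cball (0::'a) (R + norm e)"
    have [measurable]: "A \<in> sets borel" "C \<in> sets borel" by (auto simp: A_def C_def)
    have fin: "emeasure lborel A < top" "emeasure lborel C < top"
      using emeasure_bounded_finite[of A] emeasure_bounded_finite[of C] bounded_subset[OF bounded_cball, of A]
      by (auto simp: A_def C_def)
    have est: "c * measure lborel A \<le> 2 * L * norm e * measure lborel C / m" if m: "m > 0" for m :: nat
    proof -
      define t where "t = 1 / real m"
      have t: "t > 0" "real m * t = 1" using m by (auto simp: t_def)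
      have "ennreal (c * t) * emeasure lborel A \<le> (\<integral>\<^sup>+x. ennreal (D t (real k *\<^sub>R t *\<^sub>R e + x)) * indicator C x \<partial>lborel)"
        if k: "k < m" for k
      proof -
        have "ennreal (c * t) * emeasure lborel A = (\<integral>\<^sup>+x. ennreal (c * t) * indicator A x \<partial>lborel)"
          by (simp add: nn_integral_cmult_indicator)
        also have "\<dots> \<le> (\<integral>\<^sup>+x. ennreal (D t x) * indicator A x \<partial>lborel)"
          using t by (intro nn_integral_mono) (auto simp: A_def D_def indicator_def intro!: ennreal_leI)
        also have "\<dots> = (\<integral>\<^sup>+x. ennreal (D t (real k *\<^sub>R t *\<^sub>R e + x)) * indicator A (real k *\<^sub>R t *\<^sub>R e + x) \<partial>lborel)"
          by (rule nn_integral_lborel_translation[symmetric]) measurable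
        also have "\<dots> \<le> (\<integral>\<^sup>+x. ennreal (D t (real k *\<^sub>R t *\<^sub>R e + x)) * indicator C x \<partial>lborel)"
        proof (intro nn_integral_mono mult_left_mono)
          fix x
          have "real k * t \<le> 1" using k t by (metis less_imp_le mult_right_mono of_nat_le_iff)
          then have "norm (real k *\<^sub>R t *\<^sub>R e) \<le> norm e"
            using t by (simp add: mult.assoc[symmetric] mult_left_le_one_le)
          moreover have "norm x \<le> norm (real k *\<^sub>R t *\<^sub>R e + x) + norm (real k *\<^sub>R t *\<^sub>R e)"
            by (metis add.commute norm_triangle_sub add_diff_cancel_left' norm_minus_commute)
          ultimately show "indicator A (real k *\<^sub>R t *\<^sub>R e + x) \<le> (indicator C x :: ennreal)"
            by (auto simp: A_def C_def indicator_def)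
        qed simp
        finally show ?thesis .
      qed
      then have "(\<Sum>k<m. ennreal (c * t) * emeasure lborel A) \<le>
          (\<Sum>k<m. \<integral>\<^sup>+x. ennreal (D t (real k *\<^sub>R t *\<^sub>R e + x)) * indicator C x \<partial>lborel)"
        by (intro sum_mono) auto
      also have "\<dots> = (\<integral>\<^sup>+x. (\<Sum>k<m. ennreal (D t (real k *\<^sub>R t *\<^sub>R e + x)) * indicator C x) \<partial>lborel)"
        by (subst nn_integral_sum) auto
      also have "\<dots> \<le> (\<integral>\<^sup>+x. ennreal (2 * L * norm e * t) * indicator C x \<partial>lborel)"
      proof (rule nn_integral_mono)
        fix x
        have "(\<Sum>k<m. D t (real k *\<^sub>R t *\<^sub>R e + x)) \<le> 2 * L * norm e * t"
          unfolding tele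
          using lip[of "x + real m *\<^sub>R t *\<^sub>R e" "x + real m *\<^sub>R t *\<^sub>R e - t *\<^sub>R e"] lip[of x "x - t *\<^sub>R e"] t
          by (simp add: algebra_simps)
        then have "ennreal (\<Sum>k<m. D t (real k *\<^sub>R t *\<^sub>R e + x)) \<le> ennreal (2 * L * norm e * t)"
          by (rule ennreal_leI)
        then show "(\<Sum>k<m. ennreal (D t (real k *\<^sub>R t *\<^sub>R e + x)) * indicator C x) \<le>
          ennreal (2 * L * norm e * t) * indicator C x"
          using D0 by (simp add: sum_distrib_right[symmetric] sum_ennreal mult_right_mono)
      qed
      also have "\<dots> = ennreal (2 * L * norm e * t) * emeasure lborel C"
        by (simp add: nn_integral_cmult_indicator)
      finally have "of_nat m * (ennreal (c * t) * emeasure lborel A) \<le> ennreal (2 * L * norm e * t) * emeasure lborel C"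
        by simp
      then have "ennreal (real m * (c * t) * measure lborel A) \<le> ennreal (2 * L * norm e * t * measure lborel C)"
        using fin t c L0
        by (simp add: emeasure_eq_ennreal_measure ennreal_mult mult.assoc ennreal_of_nat_eq_real_of_nat)
      then have "real m * (c * t) * measure lborel A \<le> 2 * L * norm e * t * measure lborel C"
        using t L0 by (subst (asm) ennreal_le_iff) auto
      moreover have "real m * (c * t) = c" using t by simp
      ultimately show ?thesis by (simp add: t_def)
    qed
    have "c * measure lborel A \<le> 0"
    proof (rule ccontr)
      assume "\<not> ?thesis"
      then have p: "c * measure lborel A > 0" by simp
      obtain m :: nat where m: "2 * L * norm e * measure lborel C < real m * (c * measure lborel A)"
        using reals_Archimedean3[OF p] by blast
      moreover have "0 \<le> 2 * L * norm e * measure lborel C"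
        using L0 by (intro mult_nonneg_nonneg) auto
      ultimately have m0: "m > 0"
        by (cases m) auto
      then have "real m * (c * measure lborel A) \<le> 2 * L * norm e * measure lborel C"
        using est[OF m0] by (simp add: pos_le_divide_eq mult.commute)
      with m show False by simp
    qed
    then have "measure lborel A = 0"
      using c by (simp add: mult_le_0_iff measure_le_0_iff)
    then have "emeasure lborel A = 0"
      using fin by (simp add: emeasure_eq_ennreal_measure)
    then show ?thesis
      unfolding A_def[symmetric] by (auto simp: null_sets_def)
  qed
  have "?B = (\<Union>R::nat. ?B \<inter> cball 0 (real R))"
  proof (intro equalityI subsetI)
    fix x assume "x \<in> ?B"
    moreover obtain R :: nat where "norm x \<le> real R"
      using real_arch_simple by blast
    ultimately show "x \<in> (\<Union>R::nat. ?B \<inter> cball 0 (real R))"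
      by (intro UN_I[of R] IntI) auto
  qed blast
  also have "\<dots> \<in> null_sets lborel"
    using zero by (intro null_sets_UN') auto
  finally show ?thesis .
qed

section \<open>Minimizing the energy\<close>

lemma integrable_continuous_on_sphere:
  fixes f :: "real ^ 'n \<Rightarrow> real"
  assumes M: "finite_measure M" "sets M = sets sphere_borel" and f: "continuous_on (sphere 0 1) f"
  shows "integrable M f"
proof -
  interpret finite_measure M by fact
  have sp: "space M = sphere 0 1"
    using sets_eq_imp_space_eq[OF M(2)] by (simp add: space_restrict_space)
  have "f \<in> borel_measurable sphere_borel"
    by (rule borel_measurable_continuous_on_restrict[OF f])
  then have m: "f \<in> borel_measurable M"
    using M(2) by (simp cong: measurable_cong_sets)
  have "bounded (f ` sphere 0 1)"
    by (intro compact_imp_bounded compact_continuous_image f) simp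
  then obtain B where "\<forall>u\<in>sphere 0 1. norm (f u) \<le> B"
    unfolding bounded_iff by blast
  then show ?thesis
    using m by (intro integrable_const_bound[of _ B] AE_I2) (auto simp: sp)
qed

lemma sets_band:
  fixes e :: "real ^ 'n"
  shows "{u \<in> sphere 0 1. \<bar>u \<bullet> e\<bar> \<le> d} \<in> sets sphere_borel"
proof -
  have "closed {u. \<bar>u \<bullet> e\<bar> \<le> d}"
    by (intro closed_Collect_le continuous_intros)
  then have "closed (sphere 0 1 \<inter> {u. \<bar>u \<bullet> e\<bar> \<le> d})"
    by (intro closed_Int) auto
  moreover have "{u \<in> sphere 0 1. \<bar>u \<bullet> e\<bar> \<le> d} = sphere 0 1 \<inter> {u. \<bar>u \<bullet> e\<bar> \<le> d}"
    by auto
  ultimately show ?thesis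
    unfolding sphere_measurable_iff by simp
qed

text \<open>For a single e the bands shrink to the hyperplane section, so some width works. The band
  of half that width about a nearby direction stays inside, and by compactness finitely many
  directions suffice; the maximum over these keeps the gap below \<open>c\<close> strict.\<close>

lemma uniformly_small_bands:
  fixes M :: "(real ^ 'n) measure"
  assumes M: "finite_measure M" "sets M = sets sphere_borel"
    and c: "\<And>e. norm e = 1 \<Longrightarrow> measure M {u \<in> sphere 0 1. u \<bullet> e = 0} < c"
  shows "\<exists>d c'. 0 < d \<and> d \<le> 1 \<and> c' < c \<and>
    (\<forall>e. norm e = 1 \<longrightarrow> measure M {u \<in> sphere 0 1. \<bar>u \<bullet> e\<bar> \<le> d} \<le> c')"
proof -
  interpret finite_measure M by fact
  have band: "{u \<in> sphere 0 1. \<bar>u \<bullet> e\<bar> \<le> d} \<in> sets M" for e d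
    unfolding M(2) by (rule sets_band)
  have loc: "\<exists>d>0. measure M {u \<in> sphere 0 1. \<bar>u \<bullet> e\<bar> \<le> 2 * d} < c" if e: "norm e = 1" for e
  proof -
    let ?A = "\<lambda>i. {u \<in> sphere 0 1. \<bar>u \<bullet> e\<bar> \<le> 1 / real (Suc i)}"
    have "(\<lambda>i. measure M (?A i)) \<longlonglongrightarrow> measure M (\<Inter>i. ?A i)"
    proof (rule finite_Lim_measure_decseq)
      show "range ?A \<subseteq> sets M" using band by auto
      show "decseq ?A"
        by (rule decseq_SucI) (auto simp: field_simps intro: order_trans)
    qed
    moreover have "(\<Inter>i. ?A i) = {u \<in> sphere 0 1. u \<bullet> e = 0}"
    proof -
      have "x = 0" if "\<forall>i. \<bar>x\<bar> \<le> 1 / real (Suc i)" for x :: real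
      proof (rule ccontr)
        assume "x \<noteq> 0"
        then have "0 < \<bar>x\<bar>" by simp
        then obtain i where "inverse (real (Suc i)) < \<bar>x\<bar>"
          using reals_Archimedean by blast
        then show False using that[rule_format, of i] by (simp add: inverse_eq_divide)
      qed
      then show ?thesis by auto
    qed
    ultimately have "\<forall>\<^sub>F i in sequentially. measure M (?A i) < c"
      using c[OF e] by (intro order_tendstoD(2)) auto
    then obtain i where "measure M (?A i) < c"
      by (auto simp: eventually_sequentially)
    moreover have "2 * (1 / real (Suc i) / 2) = 1 / real (Suc i)"
      by (rule nonzero_mult_div_cancel_left[of "2 :: real", unfolded times_divide_eq_right[symmetric]]) simp
    ultimately have "measure M {u \<in> sphere 0 1. \<bar>u \<bullet> e\<bar> \<le> 2 * (1 / real (Suc i) / 2)} < c"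
      by (simp only:)
    then show ?thesis
      by (intro exI[of _ "1 / real (Suc i) / 2"] conjI) auto
  qed
  define d where "d e = (SOME d. d > 0 \<and> measure M {u \<in> sphere 0 1. \<bar>u \<bullet> e\<bar> \<le> 2 * d} < c)" for e
  have d: "d e > 0" "measure M {u \<in> sphere 0 1. \<bar>u \<bullet> e\<bar> \<le> 2 * d e} < c" if "norm e = 1" for e
    using someI_ex[OF loc[OF that]] by (auto simp: d_def)
  have "sphere 0 1 \<subseteq> (\<Union>e\<in>sphere 0 1. ball e (d e))"
    using d(1) by force
  then obtain F where F: "F \<subseteq> sphere 0 1" "finite F" "sphere 0 1 \<subseteq> (\<Union>e\<in>F. ball e (d e))"
    using compactE_image[of "sphere 0 1" "sphere 0 1" "\<lambda>e. ball e (d e)"] by auto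
  have "sphere 0 1 \<noteq> ({} :: (real ^ 'n) set)" by simp
  with F(3) have "F \<noteq> {}" by auto
  \<comment> \<open>The cap at 1 makes the logarithm of the width nonpositive, as
    \<open>energy_coercive\<close> needs.\<close>
  define d0 where "d0 = min 1 (Min (d ` F))"
  define c' where "c' = Max ((\<lambda>e. measure M {u \<in> sphere 0 1. \<bar>u \<bullet> e\<bar> \<le> 2 * d e}) ` F)"
  have "0 < d0" "d0 \<le> 1"
    using F \<open>F \<noteq> {}\<close> d(1) by (auto simp: d0_def)
  moreover have "c' < c"
    using F \<open>F \<noteq> {}\<close> d(2) by (auto simp: c'_def)
  moreover have "measure M {u \<in> sphere 0 1. \<bar>u \<bullet> e\<bar> \<le> d0} \<le> c'" if "norm e = 1" for e
  proof -
    from that obtain f where f: "f \<in> F" "dist f e < d f"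
      using F(3) by (force simp: ball_def)
    have df: "d0 \<le> d f" using F f by (auto simp: d0_def intro: min.coboundedI2)
    have "measure M {u \<in> sphere 0 1. \<bar>u \<bullet> e\<bar> \<le> d0} \<le> measure M {u \<in> sphere 0 1. \<bar>u \<bullet> f\<bar> \<le> 2 * d f}"
    proof (rule finite_measure_mono)
      show "{u \<in> sphere 0 1. \<bar>u \<bullet> e\<bar> \<le> d0} \<subseteq> {u \<in> sphere 0 1. \<bar>u \<bullet> f\<bar> \<le> 2 * d f}"
      proof safe
        fix u :: "real ^ 'n" assume u: "u \<in> sphere 0 1" "\<bar>u \<bullet> e\<bar> \<le> d0"
        have "\<bar>u \<bullet> f\<bar> \<le> \<bar>u \<bullet> e\<bar> + \<bar>u \<bullet> (f - e)\<bar>"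
          by (simp add: inner_diff_right)
        also have "\<bar>u \<bullet> (f - e)\<bar> \<le> d f"
          using Cauchy_Schwarz_ineq2[of u "f - e"] u(1) f(2) by (simp add: dist_norm)
        finally show "\<bar>u \<bullet> f\<bar> \<le> 2 * d f" using u df by simp
      qed
    qed (rule band)
    also have "\<dots> \<le> c'"
      unfolding c'_def using F f by (intro Max_ge) auto
    finally show "measure M {u \<in> sphere 0 1. \<bar>u \<bullet> e\<bar> \<le> d0} \<le> c'" .
  qed
  ultimately show ?thesis by blast
qed

text \<open>The minimization sees Q only through \<tau>. The hyperplane conditions are asymmetric
  because \<mu> may charge great sub-spheres and leave only a small gap below V; the \<tau>-mass of
  thin bands has to fall below whatever gap \<mu> leaves.\<close>

locale sphere_transport =
  fixes \<mu> \<tau> :: "(real ^ 'n) measure" and V :: real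
  assumes fin_\<mu>: "finite_measure \<mu>" and sets_\<mu>: "sets \<mu> = sets sphere_borel"
    and fin_\<tau>: "finite_measure \<tau>" and sets_\<tau>: "sets \<tau> = sets sphere_borel"
    and mass_\<mu>: "measure \<mu> (sphere 0 1) = V" and mass_\<tau>: "measure \<tau> (sphere 0 1) = V"
    and hyperplane_\<mu>: "\<And>e. norm e = 1 \<Longrightarrow> measure \<mu> {u \<in> sphere 0 1. u \<bullet> e = 0} < V"
    and hyperplane_\<tau>: "\<And>e. norm e = 1 \<Longrightarrow> measure \<tau> {u \<in> sphere 0 1. u \<bullet> e = 0} = 0"
begin

lemma space_\<mu>: "space \<mu> = sphere 0 1" and space_\<tau>: "space \<tau> = sphere 0 1"
  using sets_eq_imp_space_eq[OF sets_\<mu>] sets_eq_imp_space_eq[OF sets_\<tau>]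
  by (simp_all add: space_restrict_space)

lemmas integrable_\<mu> = integrable_continuous_on_sphere[OF fin_\<mu> sets_\<mu>]
  and integrable_\<tau> = integrable_continuous_on_sphere[OF fin_\<tau> sets_\<tau>]

lemma measure_space: "measure \<mu> (space \<mu>) = V" "measure \<tau> (space \<tau>) = V"
  using mass_\<mu> mass_\<tau> by (simp_all add: space_\<mu> space_\<tau>)

lemma V_pos: "0 < V"
proof -
  obtain e :: "real ^ 'n" where "norm e = 1" using vector_choose_size[of 1] by auto
  then show ?thesis using hyperplane_\<mu>[of e] measure_nonneg[of \<mu>] by (meson le_less_trans)
qed

definition energy :: "(real ^ 'n \<Rightarrow> real) \<Rightarrow> real" where
  "energy \<phi> = (\<integral>v. \<phi> v \<partial>\<mu>) + (\<integral>u. ln (conj_norm \<phi> u) \<partial>\<tau>)"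

lemma energy_mono:
  assumes \<phi>: "continuous_on (sphere 0 1) \<phi>" and \<psi>: "continuous_on (sphere 0 1) \<psi>"
    and 1: "\<And>v. norm v = 1 \<Longrightarrow> \<phi> v \<le> \<psi> v + a"
    and 2: "\<And>u. norm u = 1 \<Longrightarrow> ln (conj_norm \<phi> u) \<le> ln (conj_norm \<psi> u) + b"
  shows "energy \<phi> \<le> energy \<psi> + (a + b) * V"
proof -
  note ln = continuous_on_ln_conj_norm
  have "(\<integral>v. \<phi> v \<partial>\<mu>) \<le> (\<integral>v. \<psi> v + a \<partial>\<mu>)"
    using 1 by (intro integral_mono integrable_\<mu> continuous_intros \<phi> \<psi>) (auto simp: space_\<mu>)
  also have "\<dots> = (\<integral>v. \<psi> v \<partial>\<mu>) + a * V"
    by (subst Bochner_Integration.integral_add) (auto intro!: integrable_\<mu> \<psi> simp: measure_space)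
  finally have A: "(\<integral>v. \<phi> v \<partial>\<mu>) \<le> (\<integral>v. \<psi> v \<partial>\<mu>) + a * V" .
  have "(\<integral>u. ln (conj_norm \<phi> u) \<partial>\<tau>) \<le> (\<integral>u. ln (conj_norm \<psi> u) + b \<partial>\<tau>)"
    using 2 by (intro integral_mono integrable_\<tau> continuous_on_add continuous_on_const ln \<phi> \<psi>) (auto simp: space_\<tau>)
  also have "\<dots> = (\<integral>u. ln (conj_norm \<psi> u) \<partial>\<tau>) + b * V"
    by (subst Bochner_Integration.integral_add) (auto intro!: integrable_\<tau> ln \<psi> simp: measure_space)
  finally show ?thesis using A by (simp add: energy_def distrib_right)
qed

lemma energy_le_uniform:
  assumes \<phi>: "continuous_on (sphere 0 1) \<phi>" and \<psi>: "continuous_on (sphere 0 1) \<psi>"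
    and d: "\<And>v. norm v = 1 \<Longrightarrow> \<bar>\<phi> v - \<psi> v\<bar> \<le> d"
  shows "energy \<phi> \<le> energy \<psi> + 2 * d * V"
proof -
  have "\<phi> v \<le> \<psi> v + d" "\<psi> v \<le> \<phi> v + d" if "norm v = 1" for v
    using d[OF that] by linarith+
  then have "energy \<phi> \<le> energy \<psi> + (d + d) * V"
    using ln_conj_norm_mono[OF \<psi> \<phi>, of d] by (intro energy_mono \<phi> \<psi>) (auto simp: add.commute)
  then show ?thesis by simp
qed

lemma energy_shift:
  assumes \<phi>: "continuous_on (sphere 0 1) \<phi>"
  shows "energy (\<lambda>v. \<phi> v + c) = energy \<phi>"
proof -
  have \<psi>: "continuous_on (sphere 0 1) (\<lambda>v. \<phi> v + c)"
    by (intro continuous_intros \<phi>)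
  have "energy (\<lambda>v. \<phi> v + c) \<le> energy \<phi> + (c + - c) * V"
    using ln_conj_norm_mono[OF \<phi> \<psi>, of "-c"] by (intro energy_mono \<phi> \<psi>) auto
  moreover have "energy \<phi> \<le> energy (\<lambda>v. \<phi> v + c) + (- c + c) * V"
    using ln_conj_norm_mono[OF \<psi> \<phi>, of c] by (intro energy_mono \<phi> \<psi>) (auto simp: add.commute)
  ultimately show ?thesis by simp
qed

lemma energy_0: "energy (\<lambda>_. 0) = 0"
proof -
  have "conj_norm (\<lambda>_. 0) u = 1" if "norm u = 1" for u :: "real ^ 'n"
  proof (rule antisym)
    show "conj_norm (\<lambda>_. 0) u \<le> 1"
      using conj_norm_le_norm[of "\<lambda>_. 0" 1 u] that by simp
    show "1 \<le> conj_norm (\<lambda>_. 0) u"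
      using conj_norm_ge_norm[of "\<lambda>_. 0" u] that by (cases "u = 0") auto
  qed
  then have "(\<integral>u. ln (conj_norm (\<lambda>_. 0) u) \<partial>\<tau>) = (\<integral>u. 0 \<partial>\<tau>)"
    by (intro Bochner_Integration.integral_cong) (auto simp: space_\<tau>)
  then show ?thesis by (simp add: energy_def)
qed

text \<open>Both integrals decrease. The double conjugate is below \<phi>, and its own conjugate is
  the double conjugate of ln N_\<phi>, hence below ln N_\<phi> by the same inequality.\<close>

lemma energy_biconj:
  assumes \<phi>: "continuous_on (sphere 0 1) \<phi>"
  shows "energy (\<lambda>v. ln (conj_norm (\<lambda>u. ln (conj_norm \<phi> u)) v)) \<le> energy \<phi>"
proof -
  define \<phi>' where "\<phi>' u = ln (conj_norm \<phi> u)" for u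
  define \<psi> where "\<psi> v = ln (conj_norm \<phi>' v)" for v
  have c': "continuous_on (sphere 0 1) \<phi>'"
    unfolding \<phi>'_def by (rule continuous_on_ln_conj_norm[OF \<phi>])
  have c\<psi>: "continuous_on (sphere 0 1) \<psi>"
    unfolding \<psi>_def by (rule continuous_on_ln_conj_norm[OF c'])
  have "energy \<psi> \<le> energy \<phi> + (0 + 0) * V"
  proof (rule energy_mono[OF c\<psi> \<phi>])
    fix v :: "real ^ 'n" assume v: "norm v = 1"
    then have "v \<noteq> 0" by auto
    have "(\<lambda>u. ln (conj_norm \<phi> u)) = \<phi>'" "(\<lambda>u. ln (conj_norm \<phi>' u)) = \<psi>"
      by (simp_all add: \<phi>'_def \<psi>_def fun_eq_iff)
    note eq = this
    have "\<psi> v \<le> ln (exp (\<phi> v))"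
      unfolding \<psi>_def using conj_norm_biconj[OF \<phi> v, unfolded eq] conj_norm_pos[OF c' \<open>v \<noteq> 0\<close>]
      by (subst ln_le_cancel_iff) auto
    then show "\<psi> v \<le> \<phi> v + 0" by simp
    have "ln (conj_norm \<psi> v) \<le> ln (exp (\<phi>' v))"
      using conj_norm_biconj[OF c' v, unfolded eq] conj_norm_pos[OF c\<psi> \<open>v \<noteq> 0\<close>]
      by (subst ln_le_cancel_iff) auto
    then show "ln (conj_norm \<psi> v) \<le> ln (conj_norm \<phi> v) + 0" by (simp add: \<phi>'_def)
  qed
  moreover have "\<psi> = (\<lambda>v. ln (conj_norm (\<lambda>u. ln (conj_norm \<phi> u)) v))"
    unfolding \<psi>_def \<phi>'_def ..
  ultimately show ?thesis by simp
qed

text \<open>The replacement \<psi> is the double conjugate with a normalizing constant. It satisfies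
  \<psi>(v) \<ge> ln |v.x| for a unit vector x and \<psi> \<ge> -b with equality at some e, while ln
  N_\<psi>(u) \<ge> ln |u.e| + b and ln N_\<psi> \<ge> 0. Using the second bound of each pair only
  on the band about x or e gives E(\<psi>) \<ge> (ln d + ln d') V + b (V - c) / 2. \<open>B\<close>
  is what this allows for b when the energy is at most 0, the value at the zero function.\<close>

lemma energy_coercive:
  obtains B where "0 \<le> B"
    "\<And>\<phi>. continuous_on (sphere 0 1) \<phi> \<Longrightarrow> energy \<phi> \<le> 0 \<Longrightarrow>
      \<exists>\<psi>. energy \<psi> \<le> energy \<phi> \<and> (\<forall>v. norm v = 1 \<longrightarrow> - B \<le> \<psi> v \<and> \<psi> v \<le> 0) \<and>
        (exp B)-lipschitz_on (sphere 0 1) \<psi>"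
proof -
  obtain d c where d: "0 < d" "d \<le> 1" and c: "c < V"
    and band_\<mu>: "\<And>e. norm e = 1 \<Longrightarrow> measure \<mu> {u \<in> sphere 0 1. \<bar>u \<bullet> e\<bar> \<le> d} \<le> c"
    using uniformly_small_bands[OF fin_\<mu> sets_\<mu> hyperplane_\<mu>] by auto
  \<comment> \<open>Of the gap V - c left by \<mu>, half may be spent on the \<tau>-band; the other
    half remains as the coefficient of b.\<close>
  have "measure \<tau> {u \<in> sphere 0 1. u \<bullet> e = 0} < (V - c) / 2" if "norm e = 1" for e
    using hyperplane_\<tau>[OF that] c by simp
  note small = this
  obtain d' c' where d': "0 < d'" "d' \<le> 1" and c': "c' < (V - c) / 2"
    and band_\<tau>: "\<And>e. norm e = 1 \<Longrightarrow> measure \<tau> {u \<in> sphere 0 1. \<bar>u \<bullet> e\<bar> \<le> d'} \<le> c'"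
    using uniformly_small_bands[OF fin_\<tau> sets_\<tau> small] by auto
  define B where "B = - 2 * V * (ln d + ln d') / (V - c)"
  have ln_neg: "ln d \<le> 0" "ln d' \<le> 0" using d d' by auto
  have B0: "0 \<le> B"
    unfolding B_def using ln_neg c V_pos by (intro divide_nonneg_pos) (auto intro!: mult_nonneg_nonpos)
  show thesis
  proof (rule that[OF B0])
    fix \<phi> :: "real ^ 'n \<Rightarrow> real"
    assume \<phi>: "continuous_on (sphere 0 1) \<phi>" and neg: "energy \<phi> \<le> 0"
    define \<phi>' where "\<phi>' u = ln (conj_norm \<phi> u)" for u
    have c\<phi>': "continuous_on (sphere 0 1) \<phi>'"
      unfolding \<phi>'_def by (rule continuous_on_ln_conj_norm[OF \<phi>])
    \<comment> \<open>Geometrically, x points to a farthest point of the body of \<phi>. The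
      constant in \<psi> rescales the body so that this point becomes x itself, and exp \<psi> is
      the support function of the rescaled body; hence |v.x| \<le> exp \<psi>(v) \<le> 1.\<close>
    obtain x where x: "norm x = 1" "\<And>u. norm u = 1 \<Longrightarrow> \<phi>' x \<le> \<phi>' u"
      using continuous_attains_inf[OF compact_sphere _ c\<phi>'] by (metis mem_sphere_0 sphere_eq_empty zero_le_one not_less)
    define \<psi> where "\<psi> v = ln (conj_norm \<phi>' v) + \<phi>' x" for v
    have c\<psi>: "continuous_on (sphere 0 1) \<psi>"
      unfolding \<psi>_def by (intro continuous_on_add continuous_on_const continuous_on_ln_conj_norm c\<phi>')
    have le: "energy \<psi> \<le> energy \<phi>"
      unfolding \<psi>_def using energy_shift[OF continuous_on_ln_conj_norm[OF c\<phi>']] energy_biconj[OF \<phi>]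
      unfolding \<phi>'_def[abs_def] by simp
    have pos: "norm v = 1 \<Longrightarrow> 0 < conj_norm \<phi>' v" for v
      by (rule conj_norm_pos[OF c\<phi>']) auto
    have exp\<psi>: "exp (\<psi> v) = conj_norm \<phi>' v * exp (\<phi>' x)" if "norm v = 1" for v
      using pos[OF that] by (simp add: \<psi>_def exp_add)
    have scaled: "conj_norm \<phi>' v * exp (\<phi>' x) \<le> norm v" for v
      using conj_norm_le_norm[OF c\<phi>', of "exp (- \<phi>' x)" v] x(2) by (simp add: exp_minus field_simps)
    have \<psi>_le: "\<psi> v \<le> 0" if "norm v = 1" for v
      using scaled[of v] exp\<psi>[OF that] that by (metis exp_le_one_iff)
    have \<psi>_ge: "\<bar>v \<bullet> x\<bar> \<le> exp (\<psi> v)" if "norm v = 1" for v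
      using conj_norm_upper[OF c\<phi>' x(1), of v] exp\<psi>[OF that] by (simp add: exp_minus field_simps)
    \<comment> \<open>The direction of least width of the rescaled body; b measures how flat the
      body is.\<close>
    obtain e where e: "norm e = 1" "\<And>v. norm v = 1 \<Longrightarrow> \<psi> e \<le> \<psi> v"
      using continuous_attains_inf[OF compact_sphere _ c\<psi>] by (metis mem_sphere_0 sphere_eq_empty zero_le_one not_less)
    define b where "b = - \<psi> e"
    have b0: "0 \<le> b" using \<psi>_le[OF e(1)] by (simp add: b_def)
    note c\<psi>' = continuous_on_ln_conj_norm[OF c\<psi>]
    have u\<psi>: "0 \<le> ln (conj_norm \<psi> u)" if "norm u = 1" for u
    proof -
      have "1 \<le> exp (- \<psi> u)" using \<psi>_le[OF that] by simp
      also have "\<dots> \<le> conj_norm \<psi> u"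
        using conj_norm_upper[OF c\<psi> that, of u] that by (simp add: dot_square_norm)
      finally show ?thesis by simp
    qed
    define A where "A = {v \<in> sphere 0 1. \<bar>v \<bullet> x\<bar> \<le> d}"
    define A' where "A' = {u \<in> sphere 0 1. \<bar>u \<bullet> e\<bar> \<le> d'}"
    have A: "A \<in> sets \<mu>" "A' \<in> sets \<tau>"
      using sets_band by (auto simp: A_def A'_def sets_\<mu> sets_\<tau>)
    interpret \<mu>: finite_measure \<mu> by (rule fin_\<mu>)
    interpret \<tau>: finite_measure \<tau> by (rule fin_\<tau>)
    have iA: "integrable \<mu> (\<lambda>v. b * indicat_real A v)" "integrable \<tau> (\<lambda>v. b * indicat_real A' v)"
      using A by (auto intro!: integrable_real_indicator simp: \<mu>.emeasure_eq_measure \<tau>.emeasure_eq_measure)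
    have iB: "integrable \<mu> (\<lambda>v. ln d - b * indicat_real A v)" "integrable \<tau> (\<lambda>u. ln d' + b - b * indicat_real A' u)"
      by (rule Bochner_Integration.integrable_diff[OF \<mu>.integrable_const iA(1)],
        rule Bochner_Integration.integrable_diff[OF \<tau>.integrable_const iA(2)])
    have "(\<integral>v. ln d - b * indicat_real A v \<partial>\<mu>) \<le> (\<integral>v. \<psi> v \<partial>\<mu>)"
    proof (rule integral_mono)
      fix v assume "v \<in> space \<mu>"
      then have v: "norm v = 1" by (simp add: space_\<mu>)
      show "ln d - b * indicat_real A v \<le> \<psi> v"
      proof (cases "v \<in> A")
        case True
        then show ?thesis using e(2)[OF v] ln_neg by (simp add: b_def)
      next
        case False
        then have "d < exp (\<psi> v)" using \<psi>_ge[OF v] v by (auto simp: A_def)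
        then have "ln d < \<psi> v" using d by (metis ln_exp ln_less_cancel_iff exp_gt_zero)
        then show ?thesis using False by simp
      qed
    qed (rule iB integrable_\<mu>[OF c\<psi>])+
    also have "(\<integral>v. ln d - b * indicat_real A v \<partial>\<mu>) = ln d * V - b * measure \<mu> A"
      using A iA by (subst Bochner_Integration.integral_diff) (auto simp: measure_space)
    finally have I1: "ln d * V - b * measure \<mu> A \<le> (\<integral>v. \<psi> v \<partial>\<mu>)" .
    have "(\<integral>u. (ln d' + b) - b * indicat_real A' u \<partial>\<tau>) \<le> (\<integral>u. ln (conj_norm \<psi> u) \<partial>\<tau>)"
    proof (rule integral_mono)
      fix u assume "u \<in> space \<tau>"
      then have u: "norm u = 1" by (simp add: space_\<tau>)
      show "ln d' + b - b * indicat_real A' u \<le> ln (conj_norm \<psi> u)"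
      proof (cases "u \<in> A'")
        case True
        then show ?thesis using u\<psi>[OF u] ln_neg by simp
      next
        case False
        then have "d' * exp b \<le> \<bar>u \<bullet> e\<bar> * exp b"
          using u by (auto simp: A'_def)
        also have "\<dots> \<le> conj_norm \<psi> u"
          using conj_norm_upper[OF c\<psi> e(1), of u] by (simp add: b_def)
        finally have "ln (d' * exp b) \<le> ln (conj_norm \<psi> u)"
          using d' by (intro ln_mono) auto
        then show ?thesis using False d' by (simp add: ln_mult)
      qed
    qed (rule iB integrable_\<tau>[OF c\<psi>'])+
    also have "(\<integral>u. (ln d' + b) - b * indicat_real A' u \<partial>\<tau>) = (ln d' + b) * V - b * measure \<tau> A'"
      using A iA by (subst Bochner_Integration.integral_diff) (auto simp: measure_space)
    finally have I2: "(ln d' + b) * V - b * measure \<tau> A' \<le> (\<integral>u. ln (conj_norm \<psi> u) \<partial>\<tau>)" .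
    have "b * measure \<mu> A + b * measure \<tau> A' \<le> b * c + b * ((V - c) / 2)"
      using band_\<mu>[OF x(1)] band_\<tau>[OF e(1)] c' b0
      by (intro add_mono mult_left_mono) (auto simp: A_def A'_def)
    moreover have "b * c + b * ((V - c) / 2) = b * V - b * ((V - c) / 2)"
      by (simp add: field_simps)
    ultimately have "(ln d + ln d') * V + b * ((V - c) / 2) \<le> energy \<psi>"
      using I1 I2 unfolding energy_def distrib_right by linarith
    moreover have "b * (V - c) = 2 * (b * ((V - c) / 2))" "- 2 * V * (ln d + ln d') = - 2 * ((ln d + ln d') * V)"
      by simp_all
    ultimately have "b * (V - c) \<le> - 2 * V * (ln d + ln d')"
      using le neg by linarith
    then have bB: "b \<le> B"
      unfolding B_def using c by (subst pos_le_divide_eq) auto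
    have \<psi>B: "- B \<le> \<psi> v" if "norm v = 1" for v
      using e(2)[OF that] bB by (simp add: b_def)
    \<comment> \<open>The support function exp \<psi> is 1-Lipschitz because its body lies in the
      unit ball, and on values at least exp(-B) the logarithm has Lipschitz constant exp B. The
      inequality 1 + t \<le> exp t does the latter.\<close>
    have lip: "\<psi> v - \<psi> w \<le> exp B * norm (v - w)" if v: "norm v = 1" and w: "norm w = 1" for v w
    proof -
      have "\<psi> v - \<psi> w \<le> exp (\<psi> v - \<psi> w) - 1"
        using exp_ge_add_one_self[of "\<psi> v - \<psi> w"] by linarith
      also have "\<dots> = (exp (\<psi> v) - exp (\<psi> w)) * exp (- \<psi> w)"
        by (simp add: exp_diff exp_minus field_simps)
      also have "\<dots> \<le> norm (v - w) * exp B"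
      proof (intro mult_mono)
        have "exp (\<psi> v) - exp (\<psi> w) = (conj_norm \<phi>' v - conj_norm \<phi>' w) * exp (\<phi>' x)"
          by (simp add: exp\<psi> v w left_diff_distrib)
        also have "\<dots> \<le> conj_norm \<phi>' (v - w) * exp (\<phi>' x)"
          using conj_norm_diff[OF c\<phi>', of v w] by (intro mult_right_mono) auto
        finally show "exp (\<psi> v) - exp (\<psi> w) \<le> norm (v - w)"
          using scaled[of "v - w"] by simp
        show "exp (- \<psi> w) \<le> exp B" using \<psi>B[OF w] by simp
      qed auto
      finally show ?thesis by (simp add: mult.commute)
    qed
    have "(exp B)-lipschitz_on (sphere 0 1) \<psi>"
    proof (rule lipschitz_onI)
      fix v w :: "real ^ 'n" assume "v \<in> sphere 0 1" "w \<in> sphere 0 1"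
      then show "dist (\<psi> v) (\<psi> w) \<le> exp B * dist v w"
        using lip[of v w] lip[of w v] by (auto simp: dist_norm norm_minus_commute abs_le_iff)
    qed simp
    with le \<psi>_le \<psi>B show "\<exists>\<psi>. energy \<psi> \<le> energy \<phi> \<and> (\<forall>v. norm v = 1 \<longrightarrow> - B \<le> \<psi> v \<and> \<psi> v \<le> 0) \<and>
        (exp B)-lipschitz_on (sphere 0 1) \<psi>"
      by blast
  qed
qed

text \<open>The infimum is taken over the bounded equi-Lipschitz class \<open>X\<close> only.
  Competitors of energy at most 0 are carried into \<open>X\<close> by
  \<open>energy_coercive\<close>, and all others lose to the zero function, which lies in
  \<open>X\<close>. The limit thus minimizes among all continuous functions, as the variation
  requires.\<close>

lemma energy_minimizer:
  obtains p where "continuous_on (sphere 0 1) p"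
    "\<And>\<phi>. continuous_on (sphere 0 1) \<phi> \<Longrightarrow> energy p \<le> energy \<phi>"
proof -
  obtain B where B: "0 \<le> B"
    "\<And>\<phi>. continuous_on (sphere 0 1) \<phi> \<Longrightarrow> energy \<phi> \<le> 0 \<Longrightarrow>
      \<exists>\<psi>. energy \<psi> \<le> energy \<phi> \<and> (\<forall>v. norm v = 1 \<longrightarrow> - B \<le> \<psi> v \<and> \<psi> v \<le> 0) \<and>
        (exp B)-lipschitz_on (sphere 0 1) \<psi>"
    using energy_coercive by blast
  define X where "X = {\<psi>. (\<forall>v. norm v = 1 \<longrightarrow> - B \<le> \<psi> v \<and> \<psi> v \<le> 0) \<and> (exp B)-lipschitz_on (sphere 0 (1::real)) (\<psi> :: real ^ 'n \<Rightarrow> real)}"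
  have X0: "(\<lambda>_. 0) \<in> X"
    using B(1) by (auto simp: X_def intro!: lipschitz_onI)
  have Xc: "continuous_on (sphere 0 1) \<psi>" if "\<psi> \<in> X" for \<psi>
    using that lipschitz_on_continuous_on by (auto simp: X_def)
  have bdd: "bdd_below (energy ` X)"
  proof (rule bdd_belowI2)
    fix \<psi> assume \<psi>: "\<psi> \<in> X"
    then have "\<bar>0 - \<psi> v\<bar> \<le> B" if "norm v = 1" for v
      using that B(1) by (auto simp: X_def)
    then show "- 2 * B * V \<le> energy \<psi>"
      using energy_le_uniform[OF _ Xc[OF \<psi>], of "\<lambda>_. 0" B] energy_0 by simp
  qed
  define m where "m = Inf (energy ` X)"
  have "\<exists>\<psi>\<in>X. energy \<psi> < m + 1 / real (Suc n)" for n
    using cInf_lessD[of "energy ` X" "m + 1 / real (Suc n)"] X0 by (auto simp: m_def)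
  then obtain \<Psi> where \<Psi>: "\<And>n. \<Psi> n \<in> X" "\<And>n. energy (\<Psi> n) < m + 1 / real (Suc n)"
    by metis
  obtain p k where p: "continuous_on (sphere 0 1) p" "strict_mono (k :: nat \<Rightarrow> nat)"
    "\<And>e. 0 < e \<Longrightarrow> \<exists>N. \<forall>n x. n \<ge> N \<and> x \<in> sphere 0 1 \<longrightarrow> norm (\<Psi> (k n) x - p x) < e"
  proof (rule Arzela_Ascoli[of "sphere 0 1" \<Psi> B])
    show "norm (\<Psi> n x) \<le> B" if "x \<in> sphere 0 1" for n x
      using that \<Psi>(1)[of n] by (auto simp: X_def)
    show "\<exists>d. 0 < d \<and> (\<forall>n y. y \<in> sphere 0 1 \<and> norm (x - y) < d \<longrightarrow> norm (\<Psi> n x - \<Psi> n y) < e)"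
      if "x \<in> sphere 0 1" "0 < e" for x e
    proof (intro exI[of _ "e / exp B"] conjI allI impI)
      fix n y assume y: "y \<in> sphere 0 1 \<and> norm (x - y) < e / exp B"
      have "dist (\<Psi> n x) (\<Psi> n y) \<le> exp B * dist x y"
        using \<Psi>(1)[of n] y that by (auto simp: X_def intro: lipschitz_onD)
      also have "\<dots> < e" using y by (simp add: dist_norm field_simps)
      finally show "norm (\<Psi> n x - \<Psi> n y) < e" by (simp add: dist_norm)
    qed (use that in simp)
  qed auto
  have pm: "energy p \<le> m"
  proof (rule field_le_epsilon)
    fix e :: real assume e: "e > 0"
    define d where "d = e / (4 * V)"
    have d: "d > 0" "2 * d * V = e / 2" using e V_pos by (auto simp: d_def)
    obtain N where N: "\<And>n x. n \<ge> N \<Longrightarrow> norm x = 1 \<Longrightarrow> \<bar>\<Psi> (k n) x - p x\<bar> < d"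
      using p(3)[OF d(1)] by auto
    obtain i where i: "1 / real (Suc i) < e / 2"
      using reals_Archimedean[of "e / 2"] e by (auto simp: inverse_eq_divide)
    define n where "n = max N i"
    have "energy p \<le> energy (\<Psi> (k n)) + 2 * d * V"
      using N[of n] by (intro energy_le_uniform p Xc \<Psi>) (auto simp: n_def abs_minus_commute less_imp_le)
    also have "energy (\<Psi> (k n)) < m + 1 / real (Suc (k n))" by (rule \<Psi>)
    also have "1 / real (Suc (k n)) \<le> 1 / real (Suc i)"
      using seq_suble[OF p(2), of n] by (intro divide_left_mono) (auto simp: n_def)
    finally show "energy p \<le> m + e" using i d(2) by linarith
  qed
  show thesis
  proof (rule that[OF p(1)])
    fix \<phi> :: "real ^ 'n \<Rightarrow> real" assume \<phi>: "continuous_on (sphere 0 1) \<phi>"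
    have mX: "m \<le> energy \<psi>" if "\<psi> \<in> X" for \<psi>
      unfolding m_def by (intro cInf_lower bdd imageI that)
    show "energy p \<le> energy \<phi>"
    proof (cases "energy \<phi> \<le> 0")
      case True
      then obtain \<psi> where "energy \<psi> \<le> energy \<phi>" "\<psi> \<in> X"
        using B(2)[OF \<phi>] by (auto simp: X_def)
      then show ?thesis using pm mX by fastforce
    next
      case False
      then show ?thesis using pm mX[OF X0] energy_0 by linarith
    qed
  qed
qed

end

section \<open>The first variation\<close>

text \<open>An envelope theorem. A fixed maximizer \<open>w\<close> for \<open>p\<close> bounds the
  quotient below by -c, and maximizers \<open>v k\<close> for the perturbed functions bound it above
  by -g(v k); compactness drives g(v k) to c. Maximizers need not be unique, since v and -v may both
  occur, so only constancy of \<open>g\<close> on them is assumed.\<close>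

lemma conj_norm_variation:
  fixes p g :: "'a::euclidean_space \<Rightarrow> real"
  assumes p: "continuous_on (sphere 0 1) p" and g: "continuous_on (sphere 0 1) g" and u: "norm u = 1"
    and max: "\<And>v. norm v = 1 \<Longrightarrow> \<bar>u \<bullet> v\<bar> * exp (- p v) = conj_norm p u \<Longrightarrow> g v = c"
  shows "(\<lambda>k. (ln (conj_norm (\<lambda>v. p v + g v / real (Suc k)) u) - ln (conj_norm p u)) * real (Suc k)) \<longlonglongrightarrow> - c"
    (is "?q \<longlonglongrightarrow> _")
proof -
  define F where "F v = \<bar>u \<bullet> v\<bar> * exp (- p v)" for v
  define N where "N = conj_norm p u"
  define pk where "pk k v = p v + g v / real (Suc k)" for k v
  have pkc: "continuous_on (sphere 0 1) (pk k)" for k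
    unfolding pk_def by (intro continuous_intros p g) simp
  have u0: "u \<noteq> 0" using u by auto
  have N0: "N > 0" unfolding N_def by (rule conj_norm_pos[OF p u0])
  have FN: "F v \<le> N" if "norm v = 1" for v
    unfolding F_def N_def by (rule conj_norm_upper[OF p that])
  have Fk: "\<bar>u \<bullet> v\<bar> * exp (- pk k v) = F v * exp (- g v / real (Suc k))" for k v
    by (simp add: F_def pk_def exp_add[symmetric] mult.assoc)
  have "\<exists>v. norm v = 1 \<and> conj_norm (pk k) u = F v * exp (- g v / real (Suc k))" for k
    using conj_norm_attained[OF pkc[of k], of u] unfolding Fk by metis
  then obtain v where v: "\<And>k. norm (v k) = 1" "\<And>k. conj_norm (pk k) u = F (v k) * exp (- g (v k) / real (Suc k))"
    by metis
  obtain w where w: "norm w = 1" "F w = N"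
    using conj_norm_attained[OF p, of u] unfolding F_def N_def by metis
  have gw: "g w = c" using max[OF w(1)] w(2) by (simp add: F_def N_def)
  have lower: "N * exp (- c / real (Suc k)) \<le> conj_norm (pk k) u" for k
    using conj_norm_upper[OF pkc[of k] w(1), of u] unfolding Fk w(2) gw .
  have upper: "conj_norm (pk k) u \<le> N * exp (- g (v k) / real (Suc k))" for k
    unfolding v(2) using FN[OF v(1)] by (intro mult_right_mono) auto
  have pos: "conj_norm (pk k) u > 0" for k
    by (rule conj_norm_pos[OF pkc u0])
  have q: "?q k = (ln (conj_norm (pk k) u) - ln N) * real (Suc k)" for k
    unfolding N_def pk_def[abs_def] ..
  have q_ge: "- c \<le> ?q k" for k
  proof -
    have "ln (N * exp (- c / real (Suc k))) \<le> ln (conj_norm (pk k) u)"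
      using lower[of k] N0 by (intro ln_mono) auto
    then have "- c / real (Suc k) \<le> ln (conj_norm (pk k) u) - ln N"
      using N0 by (simp add: ln_mult)
    then show ?thesis unfolding q by (subst (asm) pos_divide_le_eq) auto
  qed
  have q_le: "?q k \<le> - g (v k)" for k
  proof -
    have "ln (conj_norm (pk k) u) \<le> ln (N * exp (- g (v k) / real (Suc k)))"
      using upper[of k] pos[of k] N0 by (intro ln_mono) auto
    then have "ln (conj_norm (pk k) u) - ln N \<le> - g (v k) / real (Suc k)"
      using N0 by (simp add: ln_mult)
    then show ?thesis unfolding q by (subst (asm) pos_le_divide_eq) auto
  qed
  have "bounded (g ` sphere 0 1)"
    by (intro compact_imp_bounded compact_continuous_image g) simp
  then obtain G where G: "\<forall>v\<in>sphere 0 1. norm (g v) \<le> G"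
    unfolding bounded_iff by blast
  have Gb: "g (v k) \<le> G" "- G \<le> g (v k)" "c \<le> G" for k
    using G[rule_format, of "v k"] G[rule_format, of w] v(1) w(1) gw by (auto simp: abs_le_iff)
  \<comment> \<open>Comparing \<open>v k\<close> with \<open>w\<close> in the perturbed problem
    shows that it nearly maximizes the unperturbed one.\<close>
  have F_ge: "N * exp (- 2 * G / real (Suc k)) \<le> F (v k)" for k
  proof -
    have "- 2 * G / real (Suc k) \<le> (- c / real (Suc k)) + g (v k) / real (Suc k)"
      unfolding add_divide_distrib[symmetric] using Gb(2)[of k] Gb(3) by (intro divide_right_mono) auto
    then have "exp (- 2 * G / real (Suc k)) \<le> exp (- c / real (Suc k)) * exp (g (v k) / real (Suc k))"
      by (simp add: exp_add[symmetric])
    then have "N * exp (- 2 * G / real (Suc k)) \<le> N * exp (- c / real (Suc k)) * exp (g (v k) / real (Suc k))"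
      using N0 by (simp add: mult.assoc)
    also have "\<dots> \<le> (F (v k) * exp (- g (v k) / real (Suc k))) * exp (g (v k) / real (Suc k))"
      using lower[of k] unfolding v(2) by (intro mult_right_mono) auto
    also have "\<dots> = F (v k)"
      by (simp add: mult.assoc exp_add[symmetric])
    finally show ?thesis .
  qed
  have "(\<lambda>k. g (v k)) \<longlonglongrightarrow> c"
  proof (rule tendstoI)
    fix e :: real assume e: "e > 0"
    \<comment> \<open>On this compact set no point maximizes F, so F stays below N by a definite
      amount and \<open>v k\<close> must leave it eventually.\<close>
    define C where "C = {v \<in> sphere 0 1. e \<le> \<bar>g v - c\<bar>}"
    have "closed (sphere 0 1 \<inter> (\<lambda>v. \<bar>g v - c\<bar>) -` {e..})"
      by (intro continuous_closed_preimage continuous_intros g) auto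
    also have "sphere 0 1 \<inter> (\<lambda>v. \<bar>g v - c\<bar>) -` {e..} = C"
      by (auto simp: C_def)
    finally have "closed C" .
    moreover have "bounded C"
      by (rule bounded_subset[OF bounded_sphere[of 0 1]]) (auto simp: C_def)
    ultimately have "compact C"
      by (simp add: compact_eq_bounded_closed)
    show "\<forall>\<^sub>F k in sequentially. dist (g (v k)) c < e"
    proof (cases "C = {}")
      case True
      then have "dist (g (v k)) c < e" for k
        using v(1)[of k] by (auto simp: C_def dist_real_def not_le)
      then show ?thesis by simp
    next
      case False
      have cF: "continuous_on C F"
        unfolding F_def by (intro continuous_intros continuous_on_subset[OF p]) (auto simp: C_def)
      obtain z where z: "z \<in> C" "\<forall>v\<in>C. F v \<le> F z"
        using continuous_attains_sup[OF \<open>compact C\<close> False cF] by blast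
      have "F z \<noteq> N"
        using max[of z] z(1) e by (auto simp: C_def F_def N_def)
      with FN[of z] z(1) have "F z < N" by (auto simp: C_def)
      have "(\<lambda>k. N * exp (- 2 * G / real (Suc k))) \<longlonglongrightarrow> N * exp 0"
        by (intro tendsto_intros LIMSEQ_Suc[OF lim_const_over_n])
      then have "\<forall>\<^sub>F k in sequentially. F z < N * exp (- 2 * G / real (Suc k))"
        using \<open>F z < N\<close> by (intro order_tendstoD(1)) auto
      then show ?thesis
      proof eventually_elim
        case (elim k)
        then have "v k \<notin> C" using z(2) F_ge[of k] by fastforce
        then show ?case using v(1)[of k] by (auto simp: C_def dist_real_def not_le)
      qed
    qed
  qed
  then have lim: "(\<lambda>k. - g (v k)) \<longlonglongrightarrow> - c" by (rule tendsto_minus)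
  show ?thesis
    by (rule tendsto_sandwich[OF always_eventually always_eventually tendsto_const lim]) (intro allI q_ge q_le)+
qed

section \<open>Finite measures on the sphere and continuous test functions\<close>

lemma sets_sphere_borel_closed:
  "sets (sphere_borel :: (real ^ 'n) measure) = sigma_sets (sphere 0 1) {C. closed C \<and> C \<subseteq> sphere 0 1}"
proof -
  have b: "sets (borel :: (real ^ 'n) measure) = sigma_sets UNIV (Collect closed)"
    by (simp add: borel_eq_closed)
  have S: "sphere 0 1 \<in> sigma_sets UNIV (Collect closed :: (real ^ 'n) set set)"
    unfolding b[symmetric] by simp
  have "(\<inter>) (sphere 0 1) ` Collect closed = {C :: (real ^ 'n) set. closed C \<and> C \<subseteq> sphere 0 1}"
    by (auto intro: closed_Int)
  then show ?thesis
    unfolding sets_restrict_space b sigma_sets_Int[OF S subset_UNIV] by simp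
qed

text \<open>The tent functions max 0 (1 - k dist(v, C)) converge to the indicator of a closed
  nonempty C, and closed sets form an intersection-stable generator. As \<open>infdist\<close> to
  the empty set is 0, that set is treated separately.\<close>

lemma measure_eqI_continuous_on_sphere:
  fixes M N :: "(real ^ 'n) measure"
  assumes M: "finite_measure M" "sets M = sets sphere_borel"
    and N: "finite_measure N" "sets N = sets sphere_borel"
    and eq: "\<And>g :: real ^ 'n \<Rightarrow> real. continuous_on (sphere 0 1) g \<Longrightarrow> (\<integral>v. g v \<partial>M) = (\<integral>v. g v \<partial>N)"
  shows "M = N"
proof -
  interpret M: finite_measure M by fact
  interpret N: finite_measure N by fact
  have lim: "(\<lambda>k. \<integral>v. max 0 (1 - real k * infdist v C) \<partial>L) \<longlonglongrightarrow> measure L C"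
    if L: "finite_measure L" "sets L = sets sphere_borel" and C: "closed C" "C \<subseteq> sphere 0 1" "C \<noteq> {}"
    for L :: "(real ^ 'n) measure" and C
  proof -
    interpret L: finite_measure L by fact
    have "C \<in> sets L" using C unfolding L(2) sphere_measurable_iff by auto
    have cont: "continuous_on (sphere 0 1) (\<lambda>v. max 0 (1 - real k * infdist v C))" for k
      by (intro continuous_intros)
    have "(\<lambda>k. \<integral>v. max 0 (1 - real k * infdist v C) \<partial>L) \<longlonglongrightarrow> (\<integral>v. indicat_real C v \<partial>L)"
    proof (rule integral_dominated_convergence[where w = "\<lambda>_. 1"])
      show "AE v in L. (\<lambda>k. max 0 (1 - real k * infdist v C)) \<longlonglongrightarrow> indicat_real C v"
      proof (rule AE_I2)
        fix v
        show "(\<lambda>k. max 0 (1 - real k * infdist v C)) \<longlonglongrightarrow> indicat_real C v"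
        proof (cases "v \<in> C")
          case True
          then show ?thesis by simp
        next
          case False
          then have pos: "infdist v C > 0"
            using C infdist_pos_not_in_closed by blast
          obtain n :: nat where n: "1 < real n * infdist v C"
            using reals_Archimedean3[OF pos] by blast
          have "max 0 (1 - real k * infdist v C) = 0" if "n \<le> k" for k
          proof -
            have "real n * infdist v C \<le> real k * infdist v C"
              using that pos by (intro mult_right_mono) auto
            then show ?thesis using n by simp
          qed
          then have "\<forall>\<^sub>F k in sequentially. max 0 (1 - real k * infdist v C) = indicat_real C v"
            using False by (auto simp: eventually_sequentially)
          then show ?thesis by (rule tendsto_eventually)
        qed
      qed
      show "AE v in L. norm (max 0 (1 - real k * infdist v C)) \<le> 1" for k
        by (rule AE_I2) (simp add: infdist_nonneg)
      show "indicat_real C \<in> borel_measurable L"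
        using \<open>C \<in> sets L\<close> by measurable
      show "(\<lambda>v. max 0 (1 - real k * infdist v C)) \<in> borel_measurable L" for k
        using integrable_continuous_on_sphere[OF L cont] by (rule borel_measurable_integrable)
    qed simp
    then show ?thesis
      using \<open>C \<in> sets L\<close> by simp
  qed
  show ?thesis
  proof (rule measure_eqI_generator_eq[where E = "{C. closed C \<and> C \<subseteq> sphere 0 1}" and \<Omega> = "sphere 0 1" and A = "\<lambda>_. sphere 0 1"])
    show "Int_stable {C :: (real ^ 'n) set. closed C \<and> C \<subseteq> sphere 0 1}"
      by (auto simp: Int_stable_def)
    show "emeasure M C = emeasure N C" if "C \<in> {C. closed C \<and> C \<subseteq> sphere 0 1}" for C
    proof (cases "C = {}")
      case False
      have "(\<lambda>k. \<integral>v. max 0 (1 - real k * infdist v C) \<partial>M) = (\<lambda>k. \<integral>v. max 0 (1 - real k * infdist v C) \<partial>N)"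
        by (rule ext, rule eq) (intro continuous_intros)
      then have "measure M C = measure N C"
        using lim[OF M, of C] lim[OF N, of C] that False LIMSEQ_unique by auto
      then show ?thesis by (simp add: M.emeasure_eq_measure N.emeasure_eq_measure)
    qed simp
  qed (use M N sets_sphere_borel_closed in auto)
qed

section \<open>Stationarity of the minimizer\<close>

context sphere_transport
begin

text \<open>Difference quotients of the energy at a minimizer are nonnegative. The \<mu>-part of
  each is the integral of \<open>g\<close>, and the \<tau>-part tends to minus the integral of g(n
  u) by \<open>conj_norm_variation\<close>, dominated by the sup norm of \<open>g\<close>. Evenness
  of \<open>g\<close> absorbs the sign ambiguity of the maximizers.\<close>

lemma energy_variation:
  fixes g :: "real ^ 'n \<Rightarrow> real"
  assumes p: "continuous_on (sphere 0 1) p"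
    and min: "\<And>\<phi>. continuous_on (sphere 0 1) \<phi> \<Longrightarrow> energy p \<le> energy \<phi>"
    and n: "n \<in> measurable \<tau> sphere_borel" and Z: "Z \<in> null_sets \<tau>"
    and max: "\<And>u v. norm u = 1 \<Longrightarrow> u \<notin> Z \<Longrightarrow> norm v = 1 \<Longrightarrow>
      \<bar>u \<bullet> v\<bar> * exp (- p v) = conj_norm p u \<Longrightarrow> v = n u \<or> v = - n u"
    and g: "continuous_on (sphere 0 1) g" and even: "\<And>v. norm v = 1 \<Longrightarrow> g (- v) = g v"
  shows "(\<integral>u. g (n u) \<partial>\<tau>) \<le> (\<integral>v. g v \<partial>\<mu>)"
proof -
  interpret \<tau>: finite_measure \<tau> by (rule fin_\<tau>)
  define pk where "pk k v = p v + g v / real (Suc k)" for k v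
  define q where "q k u = (ln (conj_norm (pk k) u) - ln (conj_norm p u)) * real (Suc k)" for k u
  have pkc: "continuous_on (sphere 0 1) (pk k)" for k
    unfolding pk_def by (intro continuous_intros p g) simp
  note ln = continuous_on_ln_conj_norm
  have qc: "continuous_on (sphere 0 1) (q k)" for k
    unfolding q_def by (intro continuous_on_mult continuous_on_diff continuous_on_const ln p pkc)
  have "bounded (g ` sphere 0 1)"
    by (intro compact_imp_bounded compact_continuous_image g) simp
  then obtain G where G: "\<forall>v\<in>sphere 0 1. norm (g v) \<le> G"
    unfolding bounded_iff by blast
  have nonneg: "0 \<le> (\<integral>v. g v \<partial>\<mu>) + (\<integral>u. q k u \<partial>\<tau>)" for k
  proof -
    have "energy (pk k) - energy p = ((\<integral>v. pk k v \<partial>\<mu>) - (\<integral>v. p v \<partial>\<mu>)) +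
        ((\<integral>u. ln (conj_norm (pk k) u) \<partial>\<tau>) - (\<integral>u. ln (conj_norm p u) \<partial>\<tau>))"
      by (simp add: energy_def)
    also have "(\<integral>v. pk k v \<partial>\<mu>) - (\<integral>v. p v \<partial>\<mu>) = (\<integral>v. g v \<partial>\<mu>) / real (Suc k)"
    proof -
      have "continuous_on (sphere 0 1) (\<lambda>v. g v / real (Suc k))"
        by (intro continuous_intros g) simp
      then show ?thesis
        unfolding pk_def using Bochner_Integration.integral_add[OF integrable_\<mu>[OF p] integrable_\<mu>]
        by (simp del: of_nat_Suc)
    qed
    also have "(\<integral>u. ln (conj_norm (pk k) u) \<partial>\<tau>) - (\<integral>u. ln (conj_norm p u) \<partial>\<tau>) =
        (\<integral>u. ln (conj_norm (pk k) u) - ln (conj_norm p u) \<partial>\<tau>)"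
      by (rule Bochner_Integration.integral_diff[symmetric]) (intro integrable_\<tau> ln p pkc)+
    finally have "0 \<le> ((\<integral>v. g v \<partial>\<mu>) / real (Suc k) +
        (\<integral>u. ln (conj_norm (pk k) u) - ln (conj_norm p u) \<partial>\<tau>)) * real (Suc k)"
      using min[OF pkc[of k]] by (intro mult_nonneg_nonneg) auto
    also have "\<dots> = (\<integral>v. g v \<partial>\<mu>) + (\<integral>u. q k u \<partial>\<tau>)"
      unfolding q_def by (simp add: distrib_right del: of_nat_Suc)
    finally show ?thesis .
  qed
  have ng: "n u \<in> sphere 0 1" if "u \<in> sphere 0 1" for u
    using measurable_space[OF n] that by (auto simp: space_\<tau> space_restrict_space)
  have "(\<lambda>k. \<integral>u. q k u \<partial>\<tau>) \<longlonglongrightarrow> (\<integral>u. - g (n u) \<partial>\<tau>)"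
  proof (rule integral_dominated_convergence[where w = "\<lambda>_. G"])
    show "(\<lambda>u. - g (n u)) \<in> borel_measurable \<tau>"
      using measurable_compose[OF n borel_measurable_continuous_on_restrict[OF g]] by simp
    show "q k \<in> borel_measurable \<tau>" for k
      using integrable_\<tau>[OF qc] by (rule borel_measurable_integrable)
    have "AE u in \<tau>. u \<notin> Z" using Z by (rule AE_not_in)
    then show "AE u in \<tau>. (\<lambda>k. q k u) \<longlonglongrightarrow> - g (n u)"
    proof (rule AE_mp, intro AE_I2 impI)
      fix u assume "u \<in> space \<tau>" "u \<notin> Z"
      then have u: "norm u = 1" "u \<notin> Z" by (auto simp: space_\<tau>)
      have gn: "g v = g (n u)" if "norm v = 1" "\<bar>u \<bullet> v\<bar> * exp (- p v) = conj_norm p u" for v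
        using max[OF u that] even[of "n u"] ng[of u] u by auto
      show "(\<lambda>k. q k u) \<longlonglongrightarrow> - g (n u)"
        unfolding q_def pk_def[abs_def] by (rule conj_norm_variation[OF p g u(1) gn])
    qed
    show "AE u in \<tau>. norm (q k u) \<le> G" for k
    proof (rule AE_I2)
      fix u assume "u \<in> space \<tau>"
      then have u: "norm u = 1" by (simp add: space_\<tau>)
      have Gk: "\<bar>g v / real (Suc k)\<bar> \<le> G / real (Suc k)" if "norm v = 1" for v
        using G that by (simp add: divide_right_mono del: of_nat_Suc)
      have "p v \<le> pk k v + G / real (Suc k)" "pk k v \<le> p v + G / real (Suc k)" if "norm v = 1" for v
        using Gk[OF that] unfolding pk_def by linarith+
      then have "ln (conj_norm (pk k) u) \<le> G / real (Suc k) + ln (conj_norm p u)"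
        "ln (conj_norm p u) \<le> G / real (Suc k) + ln (conj_norm (pk k) u)"
        using ln_conj_norm_mono[OF p pkc _ u] ln_conj_norm_mono[OF pkc p _ u] by blast+
      then have "\<bar>ln (conj_norm (pk k) u) - ln (conj_norm p u)\<bar> \<le> G / real (Suc k)"
        by linarith
      then show "norm (q k u) \<le> G"
        unfolding q_def by (simp add: abs_mult pos_le_divide_eq del: of_nat_Suc)
    qed
  qed simp
  then have "(\<lambda>k. (\<integral>v. g v \<partial>\<mu>) + (\<integral>u. q k u \<partial>\<tau>)) \<longlonglongrightarrow> (\<integral>v. g v \<partial>\<mu>) + (\<integral>u. - g (n u) \<partial>\<tau>)"
    by (intro tendsto_intros)
  then have "0 \<le> (\<integral>v. g v \<partial>\<mu>) + (\<integral>u. - g (n u) \<partial>\<tau>)"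
    by (rule LIMSEQ_le_const) (use nonneg in auto)
  then show ?thesis by simp
qed

text \<open>The variation in directions h and -h gives equality for even h. For arbitrary g take
  h(v) = g(v) + g(-v): evenness of \<mu>, and evenness of \<tau> together with oddness of
  \<open>n\<close>, turn both integrals of h into twice those of g.\<close>

lemma energy_minimizer_distr:
  assumes p: "continuous_on (sphere 0 1) p"
    and min: "\<And>\<phi>. continuous_on (sphere 0 1) \<phi> \<Longrightarrow> energy p \<le> energy \<phi>"
    and n: "n \<in> measurable \<tau> sphere_borel" and Z: "Z \<in> null_sets \<tau>"
    and max: "\<And>u v. norm u = 1 \<Longrightarrow> u \<notin> Z \<Longrightarrow> norm v = 1 \<Longrightarrow>
      \<bar>u \<bullet> v\<bar> * exp (- p v) = conj_norm p u \<Longrightarrow> v = n u \<or> v = - n u"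
    and odd: "\<And>u. norm u = 1 \<Longrightarrow> u \<notin> Z \<Longrightarrow> n (- u) = - n u"
    and even_\<mu>: "distr \<mu> sphere_borel uminus = \<mu>" and even_\<tau>: "distr \<tau> sphere_borel uminus = \<tau>"
  shows "distr \<tau> sphere_borel n = \<mu>"
proof (rule measure_eqI_continuous_on_sphere)
  interpret \<tau>: finite_measure \<tau> by (rule fin_\<tau>)
  show "finite_measure (distr \<tau> sphere_borel n)"
    by (rule \<tau>.finite_measure_distr[OF n])
  show "finite_measure \<mu>" "sets \<mu> = sets sphere_borel" "sets (distr \<tau> sphere_borel n) = sets sphere_borel"
    by (simp_all add: fin_\<mu> sets_\<mu>)
  fix g :: "real ^ 'n \<Rightarrow> real" assume g: "continuous_on (sphere 0 1) g"
  have um: "uminus \<in> measurable \<mu> sphere_borel" "uminus \<in> measurable \<tau> sphere_borel"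
    using sphere_borel_uminus sets_\<mu> sets_\<tau> by (auto cong: measurable_cong_sets)
  have bm: "f \<in> borel_measurable sphere_borel" if "continuous_on (sphere 0 1) f" for f :: "real ^ 'n \<Rightarrow> real"
    by (rule borel_measurable_continuous_on_restrict[OF that])
  have gm: "continuous_on (sphere 0 1) (\<lambda>v. g (- v))"
    by (rule continuous_on_compose2[OF g]) (auto intro!: continuous_intros)
  define h where "h v = g v + g (- v)" for v
  have h: "continuous_on (sphere 0 1) h"
    unfolding h_def by (intro continuous_intros g gm)
  have h\<mu>: "(\<integral>v. h v \<partial>\<mu>) = 2 * (\<integral>v. g v \<partial>\<mu>)"
  proof -
    have "(\<integral>v. g (- v) \<partial>\<mu>) = (\<integral>v. g v \<partial>\<mu>)"
      using integral_distr[OF um(1) bm[OF g]] even_\<mu> by simp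
    then show ?thesis
      unfolding h_def by (subst Bochner_Integration.integral_add) (auto intro!: integrable_\<mu> g gm)
  qed
  have int_n: "integrable \<tau> (\<lambda>u. f (n u))" if "continuous_on (sphere 0 1) f" for f :: "real ^ 'n \<Rightarrow> real"
  proof -
    have "integrable (distr \<tau> sphere_borel n) f"
      by (rule integrable_continuous_on_sphere[OF \<tau>.finite_measure_distr[OF n] _ that]) simp
    then show ?thesis
      using integrable_distr_eq[OF n bm[OF that]] by simp
  qed
  have h\<tau>: "(\<integral>u. h (n u) \<partial>\<tau>) = 2 * (\<integral>u. g (n u) \<partial>\<tau>)"
  proof -
    have gn: "(\<lambda>u. g (n u)) \<in> borel_measurable \<tau>" "(\<lambda>u. g (- n u)) \<in> borel_measurable \<tau>"
      using int_n[OF g] int_n[OF gm] by (auto dest: borel_measurable_integrable)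
    have nm: "(\<lambda>u. g (n u)) \<in> borel_measurable sphere_borel"
      using gn(1) sets_\<tau> by (simp cong: measurable_cong_sets)
    have "(\<integral>u. g (- n u) \<partial>\<tau>) = (\<integral>u. g (n (- u)) \<partial>\<tau>)"
    proof (rule integral_cong_AE)
      have "AE u in \<tau>. u \<notin> Z" using Z by (rule AE_not_in)
      then show "AE u in \<tau>. g (- n u) = g (n (- u))"
        by (rule AE_mp, intro AE_I2 impI) (simp add: odd space_\<tau>)
      show "(\<lambda>u. g (n (- u))) \<in> borel_measurable \<tau>"
        using measurable_compose[OF um(2) nm] by simp
    qed (rule gn)
    also have "\<dots> = (\<integral>u. g (n u) \<partial>\<tau>)"
      using integral_distr[OF um(2) nm] even_\<tau> by simp
    finally show ?thesis
      unfolding h_def by (subst Bochner_Integration.integral_add) (auto intro!: int_n g int_n[OF gm])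
  qed
  have "(\<integral>u. h (n u) \<partial>\<tau>) \<le> (\<integral>v. h v \<partial>\<mu>)"
    by (rule energy_variation[OF p min n Z max h]) (auto simp: h_def)
  moreover have "(\<integral>u. - h (n u) \<partial>\<tau>) \<le> (\<integral>v. - h v \<partial>\<mu>)"
    by (rule energy_variation[OF p min n Z max]) (auto simp: h_def intro!: continuous_intros g gm)
  ultimately have "(\<integral>u. h (n u) \<partial>\<tau>) = (\<integral>v. h v \<partial>\<mu>)" by simp
  then have "(\<integral>u. g (n u) \<partial>\<tau>) = (\<integral>v. g v \<partial>\<mu>)"
    using h\<mu> h\<tau> by simp
  then show "(\<integral>v. g v \<partial>distr \<tau> sphere_borel n) = (\<integral>v. g v \<partial>\<mu>)"
    using integral_distr[OF n bm[OF g]] by simp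
qed

end

section \<open>The radial Gauss map of the Wulff shape\<close>

text \<open>For convex N the second difference divided by t is nondecreasing in t, so each set
  collects the points where the one-sided derivatives along e differ by at least 1/(k+1). Requiring
  this for all t > 0 makes the set closed when N is continuous, and coordinate directions suffice to
  tell subgradients apart.\<close>

definition kinks :: "('a::euclidean_space \<Rightarrow> real) \<Rightarrow> 'a set" where
  "kinks N = (\<Union>e\<in>Basis. \<Union>k::nat. {x. \<forall>t>0. 1 / real (Suc k) * t \<le> N (x + t *\<^sub>R e) + N (x - t *\<^sub>R e) - 2 * N x})"

context
  fixes p :: "'a::euclidean_space \<Rightarrow> real"
  assumes p: "continuous_on (sphere 0 1) p"
begin

lemma null_sets_kinks_conj_norm: "kinks (conj_norm p) \<in> null_sets lborel"
proof -
  obtain M where M: "M > 0" "\<And>x. conj_norm p x \<le> M * norm x"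
    using conj_norm_bound[OF p] by blast
  define B where "B e k = {x. \<forall>t>0. 1 / real (Suc k) * t \<le>
    conj_norm p (x + t *\<^sub>R e) + conj_norm p (x - t *\<^sub>R e) - 2 * conj_norm p x}" for e k
  have B: "B e k \<in> null_sets lborel" for e k
    unfolding B_def
  proof (rule null_sets_kinks[where L = M])
    show "2 * conj_norm p x \<le> conj_norm p (x + h) + conj_norm p (x - h)" for x h
      using conj_norm_triangle[OF p, of "x + h" "x - h"] conj_norm_scaleR[OF p, of 2 x] by (simp add: scaleR_2)
    show "\<bar>conj_norm p x - conj_norm p y\<bar> \<le> M * norm (x - y)" for x y
      using conj_norm_diff[OF p, of x y] M(2)[of "x - y"] by linarith
  qed simp
  have "(\<Union>e\<in>Basis. \<Union>k. B e k) \<in> null_sets lborel"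
    by (intro null_sets_UN' null_sets_UN B countable_finite finite_Basis)
  then show ?thesis
    unfolding kinks_def B_def .
qed

text \<open>Homogeneity trades a dilation of x for a rescaling of t. This is the cone condition of
  \<open>null_sets_ball_projection\<close>.\<close>

lemma kinks_conj_norm_cone:
  assumes "sgn x \<in> kinks (conj_norm p)"
  shows "x \<in> kinks (conj_norm p)"
proof (cases "x = 0")
  case False
  define r where "r = norm x"
  have r: "r > 0" "x = r *\<^sub>R sgn x"
    using False by (auto simp: r_def sgn_div_norm)
  from assms obtain e k where ek: "e \<in> Basis"
    "\<And>t. t > 0 \<Longrightarrow> 1 / real (Suc k) * t \<le> conj_norm p (sgn x + t *\<^sub>R e) + conj_norm p (sgn x - t *\<^sub>R e) - 2 * conj_norm p (sgn x)"
    unfolding kinks_def by blast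
  have "1 / real (Suc k) * t \<le> conj_norm p (x + t *\<^sub>R e) + conj_norm p (x - t *\<^sub>R e) - 2 * conj_norm p x"
    if t: "t > 0" for t
  proof -
    have "r * (1 / real (Suc k) * (t / r)) \<le>
      r * (conj_norm p (sgn x + (t / r) *\<^sub>R e) + conj_norm p (sgn x - (t / r) *\<^sub>R e) - 2 * conj_norm p (sgn x))"
      using r t by (intro mult_left_mono ek) auto
    also have "\<dots> = conj_norm p (r *\<^sub>R (sgn x + (t / r) *\<^sub>R e)) + conj_norm p (r *\<^sub>R (sgn x - (t / r) *\<^sub>R e)) - 2 * conj_norm p (r *\<^sub>R sgn x)"
      using r(1) unfolding conj_norm_scaleR[OF p] by (simp add: algebra_simps)
    also have "r *\<^sub>R (sgn x + (t / r) *\<^sub>R e) = x + t *\<^sub>R e"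
      using r by (simp add: scaleR_add_right r(2)[symmetric])
    also have "r *\<^sub>R (sgn x - (t / r) *\<^sub>R e) = x - t *\<^sub>R e"
      using r by (simp add: scaleR_diff_right r(2)[symmetric])
    also have "r *\<^sub>R sgn x = x" using r by simp
    also have "r * (1 / real (Suc k) * (t / r)) = 1 / real (Suc k) * t" using r by simp
    finally show ?thesis .
  qed
  with ek(1) show ?thesis unfolding kinks_def by blast
qed (use assms in simp)

lemma kinks_conj_norm_uminus:
  assumes "x \<in> kinks (conj_norm p)"
  shows "- x \<in> kinks (conj_norm p)"
proof -
  have "conj_norm p (- x + y) = conj_norm p (x - y)" "conj_norm p (- x - y) = conj_norm p (x + y)" for y
    using conj_norm_uminus[OF p, of "x - y"] conj_norm_uminus[OF p, of "x + y"] by simp_all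
  then show ?thesis
    using assms unfolding kinks_def by (simp add: conj_norm_uminus[OF p] add.commute)
qed

text \<open>If a and b differ by \<delta> in a coordinate, using the larger slope forwards and the
  smaller one backwards bounds the second difference below by |\<delta>| t for every t, which makes
  x a kink.\<close>

lemma subgradient_unique:
  assumes x: "x \<notin> kinks (conj_norm p)"
    and a: "\<And>y. a \<bullet> y \<le> conj_norm p y" "a \<bullet> x = conj_norm p x"
    and b: "\<And>y. b \<bullet> y \<le> conj_norm p y" "b \<bullet> x = conj_norm p x"
  shows "a = b"
proof (rule ccontr)
  assume "a \<noteq> b"
  then obtain e where e: "e \<in> Basis" "a \<bullet> e \<noteq> b \<bullet> e"
    using euclidean_eqI by blast
  then have "0 < \<bar>a \<bullet> e - b \<bullet> e\<bar>" by simp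
  then obtain k where k: "1 / real (Suc k) < \<bar>a \<bullet> e - b \<bullet> e\<bar>"
    using reals_Archimedean unfolding inverse_eq_divide by blast
  have "1 / real (Suc k) * t \<le> conj_norm p (x + t *\<^sub>R e) + conj_norm p (x - t *\<^sub>R e) - 2 * conj_norm p x"
    if t: "t > 0" for t
  proof -
    have "1 / real (Suc k) * t \<le> \<bar>a \<bullet> e - b \<bullet> e\<bar> * t"
      using k t by (intro mult_right_mono) auto
    also have "\<dots> = \<bar>t * (a \<bullet> e) - t * (b \<bullet> e)\<bar>"
      using t by (simp add: abs_mult right_diff_distrib[symmetric])
    also have "\<dots> \<le> conj_norm p (x + t *\<^sub>R e) + conj_norm p (x - t *\<^sub>R e) - 2 * conj_norm p x"
      using a(1)[of "x + t *\<^sub>R e"] a(1)[of "x - t *\<^sub>R e"] b(1)[of "x + t *\<^sub>R e"] b(1)[of "x - t *\<^sub>R e"] a(2) b(2)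
      by (simp add: inner_add_right inner_diff_right abs_le_iff)
    finally show ?thesis .
  qed
  then show False using x e(1) unfolding kinks_def by blast
qed

end

section \<open>The Wulff shape as a convex body\<close>

definition Wulff_shape :: "(real ^ 'n \<Rightarrow> real) \<Rightarrow> (real ^ 'n) set" where
  "Wulff_shape p = {x. conj_norm p x \<le> 1}"

context
  fixes p :: "real ^ 'n \<Rightarrow> real"
  assumes p: "continuous_on (sphere 0 1) p"
begin

lemma origin_symmetric_Wulff_shape: "origin_symmetric (Wulff_shape p)"
proof -
  have *: "- x \<in> Wulff_shape p \<longleftrightarrow> x \<in> Wulff_shape p" for x
    by (simp add: Wulff_shape_def conj_norm_uminus[OF p])
  show ?thesis
    unfolding origin_symmetric_def
  proof (intro equalityI subsetI)
    fix x assume "x \<in> Wulff_shape p"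
    then show "x \<in> uminus ` Wulff_shape p" using * by (intro image_eqI[of _ _ "- x"]) auto
  qed (use * in auto)
qed

lemma ball_subset_Wulff_shape:
  obtains r where "r > 0" "cball 0 r \<subseteq> Wulff_shape p"
proof -
  obtain M where M: "M > 0" "\<And>x. conj_norm p x \<le> M * norm x"
    using conj_norm_bound[OF p] by blast
  have "conj_norm p x \<le> 1" if "norm x \<le> 1 / M" for x
  proof -
    have "M * norm x \<le> M * (1 / M)" using that M(1) by (intro mult_left_mono) auto
    then show ?thesis using M(2)[of x] M(1) by simp
  qed
  then show thesis
    using M(1) by (intro that[of "1 / M"]) (auto simp: Wulff_shape_def)
qed

lemma convex_body_Wulff_shape: "convex_body (Wulff_shape p)"
proof -
  have "compact (p ` sphere 0 1)"
    by (intro compact_continuous_image p) simp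
  then have "bounded (p ` sphere 0 1)" by (rule compact_imp_bounded)
  then obtain G where G: "\<forall>v\<in>sphere 0 1. norm (p v) \<le> G"
    unfolding bounded_iff by blast
  have "norm x \<le> exp G" if "x \<in> Wulff_shape p" for x
  proof (cases "x = 0")
    case False
    have "norm x * exp (- p (sgn x)) \<le> 1"
      using conj_norm_ge_norm[OF p False] that by (simp add: Wulff_shape_def)
    then have "norm x \<le> exp (p (sgn x))"
      by (simp add: exp_minus field_simps)
    also have "\<dots> \<le> exp G"
      using G[rule_format, of "sgn x"] False by (simp add: norm_sgn)
    finally show ?thesis .
  qed simp
  then have "bounded (Wulff_shape p)"
    unfolding bounded_iff by blast
  moreover have "closed (Wulff_shape p)"
    unfolding Wulff_shape_def by (intro closed_Collect_le continuous_on_conj_norm[OF p] continuous_on_const)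
  moreover have "convex (Wulff_shape p)"
  proof (rule convexI)
    fix x y u v assume xy: "x \<in> Wulff_shape p" "y \<in> Wulff_shape p" and uv: "0 \<le> (u::real)" "0 \<le> v" "u + v = 1"
    have "conj_norm p (u *\<^sub>R x + v *\<^sub>R y) \<le> u * conj_norm p x + v * conj_norm p y"
      using conj_norm_triangle[OF p, of "u *\<^sub>R x" "v *\<^sub>R y"] uv by (simp add: conj_norm_scaleR[OF p])
    also have "\<dots> \<le> u * 1 + v * 1"
      using xy uv by (intro add_mono mult_left_mono) (auto simp: Wulff_shape_def)
    finally show "u *\<^sub>R x + v *\<^sub>R y \<in> Wulff_shape p"
      using uv by (simp add: Wulff_shape_def)
  qed
  moreover have "interior (Wulff_shape p) \<noteq> {}"
  proof -
    obtain r where r: "r > 0" "cball 0 r \<subseteq> Wulff_shape p" by (rule ball_subset_Wulff_shape)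
    then have "0 \<in> interior (Wulff_shape p)"
      by (intro interiorI[of "ball 0 r"]) auto
    then show ?thesis by blast
  qed
  ultimately show ?thesis
    by (simp add: convex_body_def compact_eq_bounded_closed)
qed

lemma radial_Wulff_shape:
  assumes u: "norm u = 1"
  shows "radial (Wulff_shape p) u = 1 / conj_norm p u"
proof -
  have pos: "0 < conj_norm p u" using u by (intro conj_norm_pos[OF p]) auto
  have mem: "l *\<^sub>R u \<in> Wulff_shape p \<longleftrightarrow> \<bar>l\<bar> \<le> 1 / conj_norm p u" for l
    using pos by (simp add: Wulff_shape_def conj_norm_scaleR[OF p] pos_le_divide_eq)
  show ?thesis
    unfolding radial_def mem using pos by (intro Greatest_equality) auto
qed

lemma radial_frontier_Wulff_shape:
  assumes u: "norm u = 1"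
  shows "(1 / conj_norm p u) *\<^sub>R u \<in> frontier (Wulff_shape p)"
proof -
  define x where "x = (1 / conj_norm p u) *\<^sub>R u"
  have pos: "0 < conj_norm p u" using u by (intro conj_norm_pos[OF p]) auto
  have x1: "conj_norm p x = 1"
    using pos by (simp add: x_def conj_norm_scaleR[OF p])
  have "x \<notin> interior (Wulff_shape p)"
  proof
    assume "x \<in> interior (Wulff_shape p)"
    then obtain e where e: "e > 0" "ball x e \<subseteq> Wulff_shape p"
      unfolding mem_interior by blast
    define m where "m = norm x + 1"
    \<comment> \<open>Chosen so that stretching x by the factor 1 + d moves it by less than e; the 1
      in m keeps the denominator positive.\<close>
    define d where "d = e / (2 * m)"
    have m: "m > 0" by (simp add: m_def add_nonneg_pos)
    then have d: "d > 0" "d * m = e / 2"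
      using e(1) by (auto simp: d_def)
    then have "d * norm x < e"
      using e(1) by (simp add: distrib_left m_def)
    then have "(1 + d) *\<^sub>R x \<in> ball x e"
      using d(1) by (simp add: dist_norm scaleR_add_left)
    then have "conj_norm p ((1 + d) *\<^sub>R x) \<le> 1"
      using e(2) by (auto simp: Wulff_shape_def)
    then show False using d(1) by (simp add: conj_norm_scaleR[OF p] x1)
  qed
  moreover have "x \<in> closure (Wulff_shape p)"
    using x1 closure_subset[of "Wulff_shape p"] by (auto simp: Wulff_shape_def)
  ultimately show ?thesis by (simp add: frontier_def x_def)
qed

section \<open>Normals of the Wulff shape and its radial Gauss map\<close>

definition Wulff_normal :: "real ^ 'n \<Rightarrow> real ^ 'n \<Rightarrow> bool" where
  "Wulff_normal u v \<longleftrightarrow> outer_unit_normal (Wulff_shape p) ((1 / conj_norm p u) *\<^sub>R u) v"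

lemma reverse_radial_Gauss_image_Wulff_shape:
  "reverse_radial_Gauss_image (Wulff_shape p) \<eta> = {u \<in> sphere 0 1. \<exists>v\<in>\<eta>. Wulff_normal u v}"
  unfolding reverse_radial_Gauss_image_def inverse_spherical_image_def Wulff_normal_def
  by (auto simp: radial_Wulff_shape radial_frontier_Wulff_shape)

text \<open>At a maximizer v the slab condition |y.v| \<le> exp p(v) is tight at the boundary point
  in direction u, so a face of that slab supports the body there. The sign of u.v decides which
  face.\<close>

lemma Wulff_normal_maximizer:
  assumes u: "norm u = 1" and v: "norm v = 1" and max: "\<bar>u \<bullet> v\<bar> * exp (- p v) = conj_norm p u"
  shows "Wulff_normal u v \<or> Wulff_normal u (- v)"
proof -
  have pos: "0 < conj_norm p u" using u by (intro conj_norm_pos[OF p]) auto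
  have bound: "\<bar>v \<bullet> y\<bar> \<le> \<bar>u \<bullet> v\<bar> / conj_norm p u" if "y \<in> Wulff_shape p" for y
  proof -
    have "\<bar>y \<bullet> v\<bar> * exp (- p v) \<le> 1"
      using conj_norm_upper[OF p v, of y] that by (simp add: Wulff_shape_def)
    then have "\<bar>y \<bullet> v\<bar> \<le> exp (p v)" by (simp add: exp_minus field_simps)
    also have "\<dots> = \<bar>u \<bullet> v\<bar> / conj_norm p u"
      using max pos by (simp add: exp_minus field_simps)
    finally show ?thesis by (simp add: inner_commute)
  qed
  show ?thesis
  proof (cases "0 \<le> u \<bullet> v")
    case True
    then have "Wulff_normal u v"
      using v bound unfolding Wulff_normal_def outer_unit_normal_def by (auto simp: inner_commute abs_le_iff)
    then show ?thesis ..
  next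
    case False
    then have "Wulff_normal u (- v)"
      using v bound unfolding Wulff_normal_def outer_unit_normal_def by (auto simp: inner_commute abs_le_iff)
    then show ?thesis ..
  qed
qed

lemma Wulff_normal_exists:
  assumes u: "norm u = 1"
  shows "\<exists>v. Wulff_normal u v"
  using conj_norm_attained[OF p, of u] Wulff_normal_maximizer[OF u] by metis

lemma Wulff_normal_uminus:
  assumes "Wulff_normal u v"
  shows "Wulff_normal (- u) (- v)"
proof -
  have "- v \<bullet> y \<le> v \<bullet> ((1 / conj_norm p u) *\<^sub>R u)" if "y \<in> Wulff_shape p" for y
  proof -
    have "- y \<in> Wulff_shape p" using that by (simp add: Wulff_shape_def conj_norm_uminus[OF p])
    then have "v \<bullet> (- y) \<le> v \<bullet> ((1 / conj_norm p u) *\<^sub>R u)"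
      using assms unfolding Wulff_normal_def outer_unit_normal_def by blast
    then show ?thesis by simp
  qed
  then show ?thesis
    using assms unfolding Wulff_normal_def outer_unit_normal_def by (simp add: conj_norm_uminus[OF p])
qed

text \<open>Dividing a normal by the value of the support function at it, v.x for the boundary point
  x in direction u, gives a subgradient of the gauge. A ball about 0 inside the body makes v.x
  positive.\<close>

lemma Wulff_normal_subgradient:
  assumes u: "norm u = 1" and n: "Wulff_normal u v"
  obtains c where "c > 0" "\<And>y. (c *\<^sub>R v) \<bullet> y \<le> conj_norm p y" "(c *\<^sub>R v) \<bullet> u = conj_norm p u"
proof -
  define x where "x = (1 / conj_norm p u) *\<^sub>R u"
  have pos: "0 < conj_norm p u" using u by (intro conj_norm_pos[OF p]) auto
  have v: "norm v = 1" "\<And>y. y \<in> Wulff_shape p \<Longrightarrow> v \<bullet> y \<le> v \<bullet> x"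
    using n unfolding Wulff_normal_def outer_unit_normal_def x_def by auto
  obtain r where r: "r > 0" "cball 0 r \<subseteq> Wulff_shape p" by (rule ball_subset_Wulff_shape)
  have "r *\<^sub>R v \<in> Wulff_shape p" using r v(1) by auto
  from v(2)[OF this] have vx: "0 < v \<bullet> x"
    using r(1) v(1) by (simp add: dot_square_norm)
  show thesis
  proof (rule that[of "1 / (v \<bullet> x)"])
    show "0 < 1 / (v \<bullet> x)" using vx by simp
    show "((1 / (v \<bullet> x)) *\<^sub>R v) \<bullet> y \<le> conj_norm p y" for y
    proof (cases "y = 0")
      case False
      then have py: "0 < conj_norm p y" by (rule conj_norm_pos[OF p])
      have "v \<bullet> ((1 / conj_norm p y) *\<^sub>R y) \<le> v \<bullet> x"
        using py by (intro v(2)) (simp add: Wulff_shape_def conj_norm_scaleR[OF p])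
      then show ?thesis using py vx by (simp add: field_simps)
    qed (simp add: conj_norm_0[OF p])
    show "((1 / (v \<bullet> x)) *\<^sub>R v) \<bullet> u = conj_norm p u"
      using vx pos by (simp add: x_def field_simps)
  qed
qed

lemma Wulff_normal_unique:
  assumes u: "norm u = 1" "u \<notin> kinks (conj_norm p)" and v: "Wulff_normal u v" and w: "Wulff_normal u w"
  shows "v = w"
proof -
  obtain a where a: "a > 0" "\<And>y. (a *\<^sub>R v) \<bullet> y \<le> conj_norm p y" "(a *\<^sub>R v) \<bullet> u = conj_norm p u"
    using Wulff_normal_subgradient[OF u(1) v] by metis
  obtain b where b: "b > 0" "\<And>y. (b *\<^sub>R w) \<bullet> y \<le> conj_norm p y" "(b *\<^sub>R w) \<bullet> u = conj_norm p u"
    using Wulff_normal_subgradient[OF u(1) w] by metis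
  have eq: "a *\<^sub>R v = b *\<^sub>R w"
    by (rule subgradient_unique[OF p u(2) a(2,3) b(2,3)])
  have "norm v = 1" "norm w = 1"
    using v w by (auto simp: Wulff_normal_def outer_unit_normal_def)
  then have "a = b" using arg_cong[OF eq, of norm] a(1) b(1) by simp
  then show ?thesis using eq a(1) by simp
qed

text \<open>The pairs (u, v) with v normal in direction u form a closed relation once the condition
  is written as N(u) (v.y) \<le> v.u for all y in the body; the set in question is the projection of
  a compact set.\<close>

lemma compact_Wulff_normal:
  assumes C: "closed C" "C \<subseteq> sphere 0 1"
  shows "compact {u \<in> sphere 0 1. \<exists>v\<in>C. Wulff_normal u v}"
proof -
  define R where "R = (sphere 0 1 \<times> C) \<inter>
    (\<Inter>y\<in>Wulff_shape p. {z. conj_norm p (fst z) * (snd z \<bullet> y) \<le> snd z \<bullet> fst z})"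
  have cf: "continuous_on UNIV (\<lambda>z::(real ^ 'n) \<times> (real ^ 'n). conj_norm p (fst z))"
    by (rule continuous_on_compose2[OF continuous_on_conj_norm[OF p]]) (auto intro!: continuous_intros)
  have "compact C" using C bounded_subset[OF bounded_sphere] by (auto simp: compact_eq_bounded_closed)
  then have "compact (sphere (0 :: real ^ 'n) 1 \<times> C)" by (intro compact_Times) auto
  moreover have "closed (\<Inter>y\<in>Wulff_shape p. {z. conj_norm p (fst z) * (snd z \<bullet> y) \<le> snd z \<bullet> fst z})"
    by (intro closed_INT ballI closed_Collect_le continuous_intros cf)
  ultimately have "compact R" unfolding R_def by (rule compact_Int_closed)
  then have "compact (fst ` R)"
    by (intro compact_continuous_image continuous_intros)
  also have "fst ` R = {u \<in> sphere 0 1. \<exists>v\<in>C. Wulff_normal u v}"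
  proof -
    have "(conj_norm p u * (v \<bullet> y) \<le> v \<bullet> u) = (v \<bullet> y \<le> v \<bullet> ((1 / conj_norm p u) *\<^sub>R u))" if "norm u = 1" for u v y
    proof -
      have "0 < conj_norm p u" using that by (intro conj_norm_pos[OF p]) auto
      then show ?thesis by (simp add: field_simps)
    qed
    then have R: "(u, v) \<in> R \<longleftrightarrow> u \<in> sphere 0 1 \<and> v \<in> C \<and> Wulff_normal u v" for u v
      using C(2) unfolding R_def Wulff_normal_def outer_unit_normal_def
      by (cases "u \<in> sphere 0 1 \<and> v \<in> C") (simp_all add: subset_iff, blast)
    show ?thesis
    proof (intro set_eqI iffI)
      fix u assume "u \<in> fst ` R"
      then obtain v where "(u, v) \<in> R" by auto
      then show "u \<in> {u \<in> sphere 0 1. \<exists>v\<in>C. Wulff_normal u v}" unfolding R by blast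
    next
      fix u assume "u \<in> {u \<in> sphere 0 1. \<exists>v\<in>C. Wulff_normal u v}"
      then obtain v where "u \<in> sphere 0 1" "v \<in> C" "Wulff_normal u v" by blast
      then have "(u, v) \<in> R" unfolding R by blast
      then show "u \<in> fst ` R" by (rule image_eqI[rotated]) simp
    qed
  qed
  finally show ?thesis .
qed

text \<open>Off the null set of kinks this is the radial Gauss map of the body; its value on the kinks is
  irrelevant and chosen to keep the map measurable.\<close>

definition Wulff_Gauss :: "real ^ 'n \<Rightarrow> real ^ 'n" where
  "Wulff_Gauss u = (if u \<in> kinks (conj_norm p) then axis undefined 1 else SOME v. Wulff_normal u v)"

lemma Wulff_Gauss_iff:
  assumes "norm u = 1" "u \<notin> kinks (conj_norm p)"
  shows "Wulff_normal u v \<longleftrightarrow> v = Wulff_Gauss u"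
  using Wulff_normal_unique[OF assms] someI_ex[OF Wulff_normal_exists[OF assms(1)]] assms(2)
  unfolding Wulff_Gauss_def by auto

lemma Wulff_Gauss_sphere:
  assumes "norm u = 1"
  shows "norm (Wulff_Gauss u) = 1"
proof (cases "u \<in> kinks (conj_norm p)")
  case False
  then have "Wulff_normal u (Wulff_Gauss u)" using Wulff_Gauss_iff[OF assms False] by simp
  then show ?thesis by (simp add: Wulff_normal_def outer_unit_normal_def)
qed (simp add: Wulff_Gauss_def)

lemma measurable_Wulff_Gauss: "Wulff_Gauss \<in> measurable sphere_borel sphere_borel"
proof (rule measurable_sigma_sets[OF sets_sphere_borel_closed])
  show "{C. closed C \<and> C \<subseteq> sphere 0 1} \<subseteq> Pow (sphere (0 :: real ^ 'n) 1)" by auto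
  show "Wulff_Gauss \<in> space sphere_borel \<rightarrow> sphere 0 1"
    by (auto simp: space_restrict_space Wulff_Gauss_sphere)
  fix C :: "(real ^ 'n) set" assume "C \<in> {C. closed C \<and> C \<subseteq> sphere 0 1}"
  then have C: "closed C" "C \<subseteq> sphere 0 1" by auto
  define Z where "Z = kinks (conj_norm p)"
  have Z: "Z \<in> sets borel" using null_sets_kinks_conj_norm[OF p] by (auto simp: Z_def)
  define B where "B = {u \<in> sphere 0 1. \<exists>v\<in>C. Wulff_normal u v}"
  have B: "B \<in> sets borel"
    unfolding B_def by (rule borel_compact[OF compact_Wulff_normal[OF C]])
  \<comment> \<open>The map is constant on the kinks, so they are added to the preimage all together
    or not at all.\<close>
  have "Wulff_Gauss -` C \<inter> space sphere_borel =
    (B - Z) \<union> (if axis undefined 1 \<in> C then sphere 0 1 \<inter> Z else {})"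
  proof (rule set_eqI)
    fix u
    show "u \<in> Wulff_Gauss -` C \<inter> space sphere_borel \<longleftrightarrow>
      u \<in> (B - Z) \<union> (if axis undefined 1 \<in> C then sphere 0 1 \<inter> Z else {})"
    proof (cases "u \<in> Z")
      case True
      then show ?thesis by (auto simp: Wulff_Gauss_def Z_def space_restrict_space)
    next
      case False
      then show ?thesis
        using Wulff_Gauss_iff[of u] by (auto simp: B_def Z_def space_restrict_space)
    qed
  qed
  also have "\<dots> \<in> sets borel" using B Z by auto
  finally show "Wulff_Gauss -` C \<inter> space sphere_borel \<in> sets sphere_borel"
    by (simp add: sphere_measurable_iff space_restrict_space)
qed

end


section \<open>Prescribing the dual curvature measure\<close>

lemma symmetric_convex_body_interior:
  assumes K: "convex_body K" and sym: "origin_symmetric K"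
  shows "0 \<in> interior K"
proof -
  have "convex K" using K by (simp add: convex_body_def)
  obtain x where x: "x \<in> interior K" using K by (auto simp: convex_body_def)
  have "uminus ` interior K = interior K"
    using sym interior_negations[of K] by (simp add: origin_symmetric_def)
  then have "- x \<in> interior K" using x by blast
  with x have "(1/2) *\<^sub>R x + (1/2) *\<^sub>R (- x) \<in> interior K"
    by (intro convexD[OF convex_interior[OF \<open>convex K\<close>]]) auto
  then show ?thesis by simp
qed

lemma radial_boundary:
  assumes K: "compact K" "0 \<in> K" and u: "norm u = 1"
  shows "radial K u *\<^sub>R u \<in> K" "radial K u *\<^sub>R u \<notin> interior K"
proof -
  let ?x = "radial K u *\<^sub>R u"
  show "?x \<in> K" by (rule radial_greatest(1)[OF K u])
  show "?x \<notin> interior K"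
  proof
    assume "?x \<in> interior K"
    then obtain e where e: "e > 0" "ball ?x e \<subseteq> K"
      unfolding mem_interior by blast
    have "(radial K u + e / 2) *\<^sub>R u \<in> ball ?x e"
      using e(1) u by (simp add: dist_norm scaleR_add_left)
    then have "radial K u + e / 2 \<le> radial K u"
      using e(2) by (intro radial_greatest(2)[OF K u]) auto
    then show False using e(1) by simp
  qed
qed

lemma reverse_radial_Gauss_image_sphere:
  assumes K: "convex_body K" and sym: "origin_symmetric K"
  shows "reverse_radial_Gauss_image K (sphere 0 1) = sphere 0 1"
proof -
  have K': "compact K" "convex K" "0 \<in> interior K" "0 \<in> K"
    using K symmetric_convex_body_interior[OF assms] interior_subset by (auto simp: convex_body_def)
  have "\<exists>v\<in>sphere 0 1. outer_unit_normal K (radial K u *\<^sub>R u) v" if u: "norm u = 1" for u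
  proof -
    let ?x = "radial K u *\<^sub>R u"
    note x = radial_boundary[OF K'(1,4) u]
    have "rel_interior K = interior K"
      using K'(3) by (intro rel_interior_nonempty_interior) auto
    then obtain a where a: "a \<noteq> 0" "\<And>y. y \<in> K \<Longrightarrow> a \<bullet> ?x \<le> a \<bullet> y"
      using supporting_hyperplane_rel_boundary[OF K'(2) x(1)] x(2) by metis
    have "outer_unit_normal K ?x (- sgn a)"
      unfolding outer_unit_normal_def
      using a by (auto simp: norm_sgn sgn_div_norm divide_right_mono)
    then show ?thesis using a(1) by (intro bexI[of _ "- sgn a"]) (auto simp: norm_sgn)
  qed
  moreover have "radial K u *\<^sub>R u \<in> frontier K" if "norm u = 1" for u
    using radial_boundary[OF K'(1,4) that] closure_subset by (auto simp: frontier_def)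
  ultimately show ?thesis
    unfolding reverse_radial_Gauss_image_def inverse_spherical_image_def by auto
qed

lemma dual_curvature_0_total:
  assumes "star_body Q" "convex_body K" "origin_symmetric K"
  shows "dual_curvature_0 K Q (sphere 0 1) = emeasure lborel Q"
proof -
  have "dual_curvature_0 K Q (sphere 0 1) = emeasure (cone_measure Q) (sphere 0 1)"
    by (rule dual_curvature_0_eq_cone_measure[OF assms(1) _ null_sets.empty_sets])
      (auto simp: reverse_radial_Gauss_image_sphere[OF assms(2,3)] sphere_measurable_iff)
  then show ?thesis by (simp add: emeasure_cone_measure_sphere[OF assms(1)])
qed

lemma proper_subspace_normal:
  fixes \<xi> :: "'a::euclidean_space set"
  assumes "subspace \<xi>" "\<xi> \<noteq> UNIV"
  obtains e where "norm e = 1" "\<And>y. y \<in> \<xi> \<Longrightarrow> y \<bullet> e = 0"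
proof -
  have "dim \<xi> < DIM('a)"
    using assms by (metis dim_eq_full dim_subset_UNIV le_neq_implies_less span_eq_iff)
  then obtain x where x: "x \<noteq> 0" "\<And>y. y \<in> span \<xi> \<Longrightarrow> orthogonal x y"
    using orthogonal_to_subspace_exists by blast
  show thesis
  proof (rule that[of "sgn x"])
    show "y \<bullet> sgn x = 0" if "y \<in> \<xi>" for y
      using x(2)[OF span_base[OF that]] by (simp add: sgn_div_norm orthogonal_def inner_commute)
  qed (use x(1) in \<open>simp add: norm_sgn\<close>)
qed

lemma dual_curvature_0_not_concentrated:
  fixes Q K :: "(real ^ 'n) set"
  assumes Q: "star_body Q" and K: "convex_body K" and sym: "origin_symmetric K"
    and \<xi>: "subspace \<xi>" "\<xi> \<noteq> UNIV"
  shows "dual_curvature_0 K Q (sphere 0 1 - \<xi>) \<noteq> 0"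
proof
  assume 0: "dual_curvature_0 K Q (sphere 0 1 - \<xi>) = 0"
  obtain e where e: "norm e = 1" "\<And>y. y \<in> \<xi> \<Longrightarrow> y \<bullet> e = 0"
    using proper_subspace_normal[OF \<xi>] by blast
  have K': "compact K" "0 \<in> interior K" "0 \<in> K"
    using K symmetric_convex_body_interior[OF K sym] interior_subset by (auto simp: convex_body_def)
  obtain r where r: "r > 0" "cball 0 r \<subseteq> K"
    using K'(2) by (auto simp: mem_interior_cball)
  obtain R where R: "R > 0" "\<And>x. x \<in> K \<Longrightarrow> norm x \<le> R"
    using compact_imp_bounded[OF K'(1)] unfolding bounded_pos by blast
  \<comment> \<open>All normals at the boundary point in direction u lie in \<xi>, hence are
    orthogonal to e. As K contains the ball of radius r and lies in that of radius R, such a normal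
    v would give r \<le> h_K(v) \<le> R |u - e|; the radius r / R contradicts this.\<close>
  obtain u where u: "u \<in> ball e (r / R)" "norm u = 1" "u \<notin> reverse_radial_Gauss_image K (sphere 0 1 - \<xi>)"
    using reverse_radial_Gauss_image_misses_open[OF Q 0 open_ball _ e(1)] r R by (metis centre_in_ball divide_pos_pos)
  have "u \<in> reverse_radial_Gauss_image K (sphere 0 1)"
    using reverse_radial_Gauss_image_sphere[OF K sym] u(2) by simp
  then obtain v where v: "v \<in> sphere 0 1" "outer_unit_normal K (radial K u *\<^sub>R u) v"
    and fr: "radial K u *\<^sub>R u \<in> frontier K"
    unfolding reverse_radial_Gauss_image_def inverse_spherical_image_def by auto
  have v\<xi>: "v \<in> \<xi>"
  proof (rule ccontr)
    assume "v \<notin> \<xi>"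
    with v fr u(2) have "u \<in> reverse_radial_Gauss_image K (sphere 0 1 - \<xi>)"
      unfolding reverse_radial_Gauss_image_def inverse_spherical_image_def by auto
    with u(3) show False by simp
  qed
  define s where "s = radial K u"
  have sK: "s *\<^sub>R u \<in> K" and s0: "0 \<le> s"
    using radial_greatest[OF K'(1,3) u(2)] K'(3) unfolding s_def by (auto dest: meta_spec[of _ 0])
  have "s \<le> R" using R(2)[OF sK] s0 u(2) by simp
  have "r *\<^sub>R v \<in> K" using r v(1) by auto
  then have "v \<bullet> (r *\<^sub>R v) \<le> v \<bullet> (s *\<^sub>R u)"
    using v(2) unfolding outer_unit_normal_def s_def by blast
  then have "r \<le> s * (v \<bullet> u)"
    using v(1) by (simp add: dot_square_norm)
  also have "v \<bullet> u = v \<bullet> (u - e)"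
    using e(2)[OF v\<xi>] by (simp add: inner_diff_right)
  also have "s * (v \<bullet> (u - e)) \<le> s * norm (u - e)"
    using norm_cauchy_schwarz[of v "u - e"] v(1) s0 by (intro mult_left_mono) auto
  also have "\<dots> \<le> R * norm (u - e)"
    using \<open>s \<le> R\<close> by (intro mult_right_mono) auto
  also have "\<dots> < r"
    using u(1) R(1) by (simp add: dist_norm norm_minus_commute field_simps)
  finally show False by simp
qed

section \<open>Sufficiency and the equivalence\<close>

lemma even_measure_distr:
  fixes \<mu> :: "(real ^ 'n) measure"
  assumes sets: "sets \<mu> = sets sphere_borel" and even: "even_measure \<mu>"
  shows "distr \<mu> sphere_borel uminus = \<mu>"
proof (rule measure_eqI)
  have um: "uminus \<in> measurable \<mu> sphere_borel"
    using sphere_borel_uminus sets by (auto cong: measurable_cong_sets)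
  have sp: "space \<mu> = sphere 0 1"
    using sets_eq_imp_space_eq[OF sets] by (simp add: space_restrict_space)
  fix A assume "A \<in> sets (distr \<mu> sphere_borel uminus)"
  then have A: "A \<in> sets sphere_borel" "A \<subseteq> sphere 0 1" by (auto simp: sphere_measurable_iff)
  have "uminus -` A \<inter> space \<mu> = uminus ` A"
  proof safe
    fix x assume "- x \<in> A" then show "x \<in> uminus ` A" by (metis image_eqI minus_minus)
  qed (use A(2) sp in auto)
  then have "emeasure (distr \<mu> sphere_borel uminus) A = emeasure \<mu> (uminus ` A)"
    using emeasure_distr[OF um A(1)] by simp
  also have "\<dots> = emeasure \<mu> A"
    using even A(1) sets by (simp add: even_measure_def)
  finally show "emeasure (distr \<mu> sphere_borel uminus) A = emeasure \<mu> A" .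
qed (simp add: sets)

lemma cone_measure_hyperplane:
  assumes Q: "star_body Q" and e: "norm e = 1"
  shows "measure (cone_measure Q) {u \<in> sphere 0 1. u \<bullet> e = 0} = 0"
proof -
  have "e \<noteq> 0" using e by auto
  then have "negligible {x. e \<bullet> x = 0}" by (intro negligible_hyperplane) auto
  moreover have "closed {x. e \<bullet> x = 0}" by (rule closed_hyperplane)
  ultimately have "{x. e \<bullet> x = 0} \<in> null_sets lborel"
    by (simp add: negligible_iff_null_sets null_sets_completion_iff)
  moreover have "x \<in> {x. e \<bullet> x = 0}" if "sgn x \<in> {x. e \<bullet> x = 0}" for x
    using that by (auto simp: sgn_div_norm)
  ultimately have "{x. e \<bullet> x = 0} \<inter> sphere 0 1 \<in> null_sets (cone_measure Q)"
    by (intro null_sets_cone_measure[OF Q] null_sets_ball_projection)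
  moreover have "{x. e \<bullet> x = 0} \<inter> sphere 0 1 = {u \<in> sphere 0 1. u \<bullet> e = 0}"
    by (auto simp: inner_commute)
  ultimately show ?thesis by (simp add: null_sets_def measure_def)
qed

text \<open>Off the null set of kinks the reverse radial Gauss image of \<eta> is the preimage of
  \<eta> under \<open>Wulff_Gauss\<close>, so the curvature measure of the Wulff shape is the
  pushforward that minimality identifies with \<mu>.\<close>

lemma even_dual_curvature_existence:
  fixes Q :: "(real ^ 'n) set" and \<mu> :: "(real ^ 'n) measure"
  assumes Q: "star_body Q" "origin_symmetric Q"
    and \<mu>: "sets \<mu> = sets sphere_borel" "finite_measure \<mu>" "even_measure \<mu>"
    and spread: "\<And>S. great_subsphere S \<Longrightarrow> \<not> concentrated_on \<mu> S"
    and total: "emeasure \<mu> (sphere 0 1) = emeasure lborel Q"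
  shows "\<exists>K. convex_body K \<and> origin_symmetric K \<and>
    (\<forall>\<eta>\<in>sets sphere_borel. dual_curvature_0 K Q \<eta> = emeasure \<mu> \<eta>)"
proof -
  interpret \<mu>: finite_measure \<mu> by fact
  have sp: "space \<mu> = sphere 0 1"
    using sets_eq_imp_space_eq[OF \<mu>(1)] by (simp add: space_restrict_space)
  define V where "V = measure \<mu> (sphere 0 1)"
  interpret sphere_transport \<mu> "cone_measure Q" V
  proof (rule sphere_transport.intro)
    show "measure (cone_measure Q) (sphere 0 1) = V"
      using emeasure_cone_measure_sphere[OF Q(1)] total by (simp add: V_def measure_def)
    show "measure \<mu> {u \<in> sphere 0 1. u \<bullet> e = 0} < V" if e: "norm e = 1" for e
    proof -
      let ?H = "{x. e \<bullet> x = 0}"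
      have "subspace ?H" by (rule subspace_hyperplane)
      moreover have "e \<notin> ?H" using e by (auto simp: dot_square_norm)
      ultimately have "great_subsphere (sphere 0 1 \<inter> ?H)"
        unfolding great_subsphere_def by blast
      then have "emeasure \<mu> (sphere 0 1 - (sphere 0 1 \<inter> ?H)) \<noteq> 0"
        using spread unfolding concentrated_on_def by blast
      then have pos: "0 < measure \<mu> (sphere 0 1 - (sphere 0 1 \<inter> ?H))"
        by (simp add: \<mu>.emeasure_eq_measure less_le)
      have "sphere 0 1 \<inter> ?H \<in> sets \<mu>" "sphere 0 1 \<in> sets \<mu>"
        using closed_hyperplane[of e 0] unfolding \<mu>(1) sphere_measurable_iff by auto
      then have "measure \<mu> (sphere 0 1 - (sphere 0 1 \<inter> ?H)) = V - measure \<mu> (sphere 0 1 \<inter> ?H)"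
        unfolding V_def by (intro \<mu>.finite_measure_Diff) auto
      moreover have "sphere 0 1 \<inter> ?H = {u \<in> sphere 0 1. u \<bullet> e = 0}"
        by (auto simp: inner_commute)
      ultimately show ?thesis using pos by simp
    qed
    show "measure (cone_measure Q) {u \<in> sphere 0 1. u \<bullet> e = 0} = 0" if "norm e = 1" for e
      by (rule cone_measure_hyperplane[OF Q(1) that])
    show "finite_measure (cone_measure Q)" by (rule finite_cone_measure[OF Q(1)])
  qed (fact \<mu> sets_cone_measure V_def[symmetric])+
  obtain p where p: "continuous_on (sphere 0 1) p"
    "\<And>\<phi>. continuous_on (sphere 0 1) \<phi> \<Longrightarrow> energy p \<le> energy \<phi>"
    using energy_minimizer by blast
  define Z where "Z = kinks (conj_norm p) \<inter> sphere 0 1"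
  have Z: "Z \<in> null_sets ball_projection"
    unfolding Z_def
    by (rule null_sets_ball_projection[OF null_sets_kinks_conj_norm[OF p(1)] kinks_conj_norm_cone[OF p(1)]])
  have nk: "u \<notin> kinks (conj_norm p)" if "norm u = 1" "u \<notin> Z" for u
    using that by (auto simp: Z_def)
  note iff = Wulff_Gauss_iff[OF p(1)]
  have n: "Wulff_Gauss p \<in> measurable (cone_measure Q) sphere_borel"
    using measurable_Wulff_Gauss[OF p(1)] by (simp cong: measurable_cong_sets)
  have push: "distr (cone_measure Q) sphere_borel (Wulff_Gauss p) = \<mu>"
  proof (rule energy_minimizer_distr[OF p n null_sets_cone_measure[OF Q(1) Z]])
    fix u v :: "real ^ 'n"
    assume u: "norm u = 1" "u \<notin> Z" and v: "norm v = 1" "\<bar>u \<bullet> v\<bar> * exp (- p v) = conj_norm p u"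
    show "v = Wulff_Gauss p u \<or> v = - Wulff_Gauss p u"
      using Wulff_normal_maximizer[OF p(1) u(1) v] iff[OF u(1) nk[OF u]] by (metis minus_minus)
  next
    fix u :: "real ^ 'n" assume u: "norm u = 1" "u \<notin> Z"
    have "Wulff_normal p (- u) (- Wulff_Gauss p u)"
      using iff[OF u(1) nk[OF u]] by (intro Wulff_normal_uminus[OF p(1)]) simp
    moreover have "- u \<notin> kinks (conj_norm p)"
      using kinks_conj_norm_uminus[OF p(1), of "- u"] nk[OF u] by auto
    ultimately show "Wulff_Gauss p (- u) = - Wulff_Gauss p u"
      using iff[of "- u"] u(1) by simp
  qed (assumption | rule even_measure_distr[OF \<mu>(1,3)] even_cone_measure[OF Q])+
  have "dual_curvature_0 (Wulff_shape p) Q \<eta> = emeasure \<mu> \<eta>" if \<eta>: "\<eta> \<in> sets sphere_borel" for \<eta>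
  proof -
    let ?A = "Wulff_Gauss p -` \<eta> \<inter> space (cone_measure Q)"
    have "dual_curvature_0 (Wulff_shape p) Q \<eta> = emeasure (cone_measure Q) ?A"
    proof (rule dual_curvature_0_eq_cone_measure[OF Q(1) _ Z])
      show "?A \<in> sets sphere_borel"
        using measurable_sets[OF n \<eta>] by simp
      fix u :: "real ^ 'n" assume "u \<in> sphere 0 1 - Z"
      then show "u \<in> reverse_radial_Gauss_image (Wulff_shape p) \<eta> \<longleftrightarrow> u \<in> ?A"
        using iff[OF _ nk, of u] by (auto simp: reverse_radial_Gauss_image_Wulff_shape[OF p(1)])
    qed
    also have "\<dots> = emeasure \<mu> \<eta>"
      using emeasure_distr[OF n \<eta>] push by simp
    finally show ?thesis .
  qed
  then show ?thesis
    using convex_body_Wulff_shape[OF p(1)] origin_symmetric_Wulff_shape[OF p(1)] by blast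
qed

theorem theorem1p3:
  fixes Q :: "(real ^ 'n) set" and \<mu> :: "(real ^ 'n) measure"
  assumes "star_body Q" and "origin_symmetric Q"
    and "sets \<mu> = sets sphere_borel" and "finite_measure \<mu>" and "even_measure \<mu>"
  shows "(\<exists>K. convex_body K \<and> origin_symmetric K \<and>
            (\<forall>\<eta>\<in>sets sphere_borel. dual_curvature_0 K Q \<eta> = emeasure \<mu> \<eta>)) \<longleftrightarrow>
         (\<forall>S. great_subsphere S \<longrightarrow> \<not> concentrated_on \<mu> S) \<and>
         emeasure \<mu> (sphere 0 1) = emeasure lborel Q"
proof
  assume "\<exists>K. convex_body K \<and> origin_symmetric K \<and>
    (\<forall>\<eta>\<in>sets sphere_borel. dual_curvature_0 K Q \<eta> = emeasure \<mu> \<eta>)"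
  then obtain K where K: "convex_body K" "origin_symmetric K"
    and eq: "\<And>\<eta>. \<eta> \<in> sets sphere_borel \<Longrightarrow> dual_curvature_0 K Q \<eta> = emeasure \<mu> \<eta>"
    by blast
  have "\<not> concentrated_on \<mu> S" if S: "great_subsphere S" for S
  proof -
    obtain \<xi> where \<xi>: "subspace \<xi>" "\<xi> \<noteq> UNIV" "S = sphere 0 1 \<inter> \<xi>"
      using S unfolding great_subsphere_def by blast
    have "sphere 0 1 - \<xi> \<in> sets sphere_borel"
      using closed_subspace[OF \<xi>(1)] by (auto simp: sphere_measurable_iff)
    moreover have "sphere 0 1 - S = sphere 0 1 - \<xi>" using \<xi>(3) by auto
    ultimately show ?thesis
      using dual_curvature_0_not_concentrated[OF assms(1) K \<xi>(1,2)] eq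
      unfolding concentrated_on_def by simp
  qed
  moreover have "emeasure \<mu> (sphere 0 1) = emeasure lborel Q"
    using dual_curvature_0_total[OF assms(1) K] eq[of "sphere 0 1"] by (simp add: sphere_measurable_iff)
  ultimately show "(\<forall>S. great_subsphere S \<longrightarrow> \<not> concentrated_on \<mu> S) \<and>
    emeasure \<mu> (sphere 0 1) = emeasure lborel Q" by blast
next
  assume "(\<forall>S. great_subsphere S \<longrightarrow> \<not> concentrated_on \<mu> S) \<and>
    emeasure \<mu> (sphere 0 1) = emeasure lborel Q"
  then show "\<exists>K. convex_body K \<and> origin_symmetric K \<and>
    (\<forall>\<eta>\<in>sets sphere_borel. dual_curvature_0 K Q \<eta> = emeasure \<mu> \<eta>)"
    using even_dual_curvature_existence[OF assms] by blast
qed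

end
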